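(* Let $n\ge 4$ be an integer, let $q = \frac{(n+2)(n-2)}{2}+1$, and for real $b\neq 0$ let $H_{(b)}$ and $K$ be the $2n\times 2n$ real symmetric matrices defined in the context. Let $$X=\begin{pmatrix}1&0\\0&0\end{pmatrix},\qquad Y=\begin{pmatrix}0&1/q^2\\1/q^2&1\end{pmatrix}.$$ Then for almost all real $b \neq 0$ (that is, for all $b$ outside a set of Lebesgue measure zero), the $4n\times 4n$ matrix $X\otimes H_{(b)}+Y\otimes K$ has at least $6$ simple eigenvalues.
   Context: Note that $q=\frac{n^2}{2}-1$. Set $$\alpha = \begin{pmatrix}1&0\\0&-1\end{pmatrix},\quad \beta = \begin{pmatrix}0&1\\1&0\end{pmatrix},\quad U=\begin{pmatrix}0&-1\\1&0\end{pmatrix}.$$ For $b\in\mathbb{R}$, $A_{(b)}$ is the $2n\times 2n$ real matrix, viewed as an $n\times n$ array of $2\times2$ blocks, with: $(i,i)$ block equal to $(q+i-1)U$ for $1\le i\le n$; $(1,j)$ block equal to $\alpha$ and $(j,1)$ block equal to $-\alpha$ for $2\le j\le n$; $(2,3)$ block equal to $b\alpha+\beta$ and $(3,2)$ block equal to $-b\alpha-\beta$; $(2,4)$ block equal to $b\alpha$ and $(4,2)$ block equal to $-b\alpha$; all other blocks zero. $B=I_n\otimes U$ is block diagonal with all $n$ diagonal $2\times2$ blocks equal to $U$. Define $H_{(b)}=(A_{(b)})^2$ and $K=A_{(b)}B+BA_{(b)}$ ($K$ does not depend on $b$). $\otimes$ is the Kronecker product. A simple eigenvalue is one of multiplicity one.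 *)

theory Defs
  imports "HOL-Analysis.Lebesgue_Measure" "Jordan_Normal_Form.Char_Poly"
begin

definition kronecker_prod :: "'a::times mat \<Rightarrow> 'a mat \<Rightarrow> 'a mat"  (infixl "\<otimes>\<^sub>K" 70) where
  "A \<otimes>\<^sub>K B = mat (dim_row A * dim_row B) (dim_col A * dim_col B)
     (\<lambda>(i, j). A $$ (i div dim_row B, j div dim_col B) * B $$ (i mod dim_row B, j mod dim_col B))"

definition alpha_mat :: "real mat" where
  "alpha_mat = mat_of_rows_list 2 [[1, 0], [0, -1]]"

definition beta_mat :: "real mat" where
  "beta_mat = mat_of_rows_list 2 [[0, 1], [1, 0]]"

definition U_mat :: "real mat" where
  "U_mat = mat_of_rows_list 2 [[0, -1], [1, 0]]"

text \<open>Real division: for odd \<open>n\<close> the number \<open>q\<close> is a half-integer.\<close>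

definition q_of :: "nat \<Rightarrow> real" where
  "q_of n = (real n + 2) * (real n - 2) / 2 + 1"

text \<open>The block in block row \<open>i\<close> and block column \<open>j\<close>; blocks are numbered from 1.\<close>

definition A_block :: "nat \<Rightarrow> real \<Rightarrow> nat \<Rightarrow> nat \<Rightarrow> real mat" where
  "A_block n b i j =
     (if i = j then (q_of n + real i - 1) \<cdot>\<^sub>m U_mat
      else if i = 1 then alpha_mat
      else if j = 1 then - alpha_mat
      else if (i, j) = (2, 3) then b \<cdot>\<^sub>m alpha_mat + beta_mat
      else if (i, j) = (3, 2) then - (b \<cdot>\<^sub>m alpha_mat) - beta_mat
      else if (i, j) = (2, 4) then b \<cdot>\<^sub>m alpha_mat
      else if (i, j) = (4, 2) then - (b \<cdot>\<^sub>m alpha_mat)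
      else 0\<^sub>m 2 2)"

text \<open>Matrix entries are indexed from 0, hence the shift to the 1-based block numbers.\<close>

definition A_mat :: "nat \<Rightarrow> real \<Rightarrow> real mat" where
  "A_mat n b = mat (2 * n) (2 * n)
     (\<lambda>(i, j). A_block n b (i div 2 + 1) (j div 2 + 1) $$ (i mod 2, j mod 2))"

definition B_mat :: "nat \<Rightarrow> real mat" where
  "B_mat n = 1\<^sub>m n \<otimes>\<^sub>K U_mat"

definition H_mat :: "nat \<Rightarrow> real \<Rightarrow> real mat" where
  "H_mat n b = A_mat n b * A_mat n b"

text \<open>The right-hand side does not depend on \<open>b\<close>, since \<open>U_mat\<close> anticommutes with
  \<open>alpha_mat\<close> and \<open>beta_mat\<close>; the parameter is kept so that this is not built in.\<close>

definition K_mat :: "nat \<Rightarrow> real \<Rightarrow> real mat" where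
  "K_mat n b = A_mat n b * B_mat n + B_mat n * A_mat n b"

definition X_mat :: "real mat" where
  "X_mat = mat_of_rows_list 2 [[1, 0], [0, 0]]"

definition Y_mat :: "nat \<Rightarrow> real mat" where
  "Y_mat n = mat_of_rows_list 2 [[0, 1 / (q_of n)\<^sup>2], [1 / (q_of n)\<^sup>2, 1]]"

text \<open>The multiplicity is the algebraic one. For the real symmetric matrices considered here it
  agrees with the geometric multiplicity, and all complex eigenvalues are real.\<close>

definition simple_eigenvalue :: "'a::field mat \<Rightarrow> 'a \<Rightarrow> bool" where
  "simple_eigenvalue M e \<longleftrightarrow> eigenvalue M e \<and> order e (char_poly M) = 1"

end

theory Submission
  imports Defs "Jordan_Normal_Form.Schur_Decomposition" "Subresultants.Subresultant_Gcd"
    "HOL-Computational_Algebra.Field_as_Ring"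
begin

text \<open>
  The characteristic polynomial of the pencil is a polynomial in \<open>b\<close> and the eigenvalue \<open>e\<close>.
  The number of its simple roots in \<open>e\<close> can drop below the number at one particular parameter only at
  finitely many \<open>b\<close>: the prime factors of multiplicity one carry all simple roots, and they stay
  squarefree and coprime to the remaining factors wherever a resultant does not vanish
  (\<open>finite_fewer_simple_roots\<close>). All roots are real since the pencil is symmetric. So it
  suffices to find six simple eigenvalues at \<open>b = 0\<close>.

  There the pencil falls apart. Read \<open>\<real>\<^sup>2\<^sup>n\<close> as complex \<open>n\<close>-space, with \<open>U\<close> as multiplication by
  \<open>\<i>\<close> and \<open>\<alpha>\<close> as complex conjugation. Then \<open>A\<close> is \<open>z \<mapsto> \<i> D z + T (cnj z)\<close> with a
  diagonal \<open>D\<close> and a complex antisymmetric \<open>T\<close>; for \<open>b = 0\<close> the graph of the nonzero entries of \<open>T\<close>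
  has a single cycle, the triangle on the first three vertices, and the substitution \<open>z\<^sub>j \<mapsto> \<i> z\<^sub>j\<close>
  for all vertices but the first turns \<open>T\<close> into \<open>-\<i>\<close> times a real antisymmetric \<open>S\<close>. Real and
  imaginary parts then separate (\<open>A_mat_swaps_halves\<close>), and the pencil becomes the direct sum of the two matrices

    \<open>( -(D - s S)(D + s S)   -C )\<close>
    \<open>(        -C            -2D )\<close>   with \<open>C = 2 D / q\<^sup>2\<close> and \<open>s = 1\<close> or \<open>s = -1\<close>,

  called halves below. The value of \<open>q\<close> is large enough to make the Gershgorin discs of a half
  disjoint, so each half has one-dimensional eigenspaces (\<open>pivot_component\<close>). An eigenvalue of the
  pencil is therefore simple unless it belongs to both halves, and then it is double.

  The two halves differ only in the sign of \<open>S\<close>, and a sign can be felt only around an odd cycle, that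
  is, through the triangle. Eliminating the lower block and all vertices outside the triangle leaves a
  small determinant whose part odd in \<open>s\<close> is a Vandermonde determinant in the diagonal entries
  (\<open>core_det_odd_part\<close>, \<open>pencil_det_vertex\<close>). It turns the condition for a common eigenvalue
  into a nonzero polynomial equation of degree \<open>2 n - 6\<close> (\<open>common_eigenvalue_equation\<close>). With at most
  \<open>2 n - 6\<close> double eigenvalues among \<open>4 n\<close>, at least \<open>12\<close> are simple.
\<close>

section \<open>Simple roots of a monic polynomial depending on a parameter\<close>

abbreviation specialize :: "real \<Rightarrow> real poly poly \<Rightarrow> real poly" where
  "specialize b \<equiv> map_poly (\<lambda>c. poly c b)"

lemma specialize_mult: "specialize b (p * q) = specialize b p * specialize b q"
proof -
  interpret map_poly_comm_ring_hom "\<lambda>c::real poly. poly c b" ..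
  show ?thesis by (rule hom_mult)
qed

lemma specialize_dvd: "p dvd q \<Longrightarrow> specialize b p dvd specialize b q"
  by (auto simp: dvd_def specialize_mult)

lemma specialize_pderiv: "specialize b (pderiv p) = pderiv (specialize b p)"
  by (rule poly_eqI) (simp add: coeff_pderiv coeff_map_poly)

lemma specialize_prod_mset_root:
  assumes "poly (specialize b (prod_mset M)) x = 0"
  shows "\<exists>p\<in>#M. poly (specialize b p) x = 0"
  using assms by (induction M) (auto simp: specialize_mult)

text \<open>In characteristic \<open>0\<close> the derivative is nonzero and of smaller degree; this makes
  prime polynomials of positive degree separable.\<close>

lemma pderiv_prime_not_dvd:
  fixes p :: "real poly poly"
  assumes "prime_elem p" "degree p > 0"
  shows "\<not> p dvd pderiv p"
proof
  assume "p dvd pderiv p"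
  moreover have "pderiv p \<noteq> 0" using assms by (simp add: pderiv_eq_0_iff)
  ultimately have "degree p \<le> degree (pderiv p)" by (rule dvd_imp_degree_le)
  with assms show False by (simp add: degree_pderiv)
qed

lemma specialize_monic_nonzero:
  assumes "lead_coeff P = 1"
  shows "specialize b P \<noteq> 0"
proof
  assume "specialize b P = 0"
  then have "coeff (specialize b P) (degree P) = 0" by simp
  with assms show False by (simp add: coeff_map_poly)
qed

text \<open>\<open>A\<close> collects the prime factors of multiplicity one and \<open>R\<close> the others. A root of a
  specialization of \<open>R\<close> is a root of a prime whose square divides \<open>P\<close>, hence never simple. The
  resultant is nonzero because \<open>A\<close> is squarefree and shares no prime with \<open>R\<close>. This is a
  factorization over the polynomial ring in the parameter, so it can be specialized at every \<open>b\<close>.\<close>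

lemma simple_part_decomposition:
  fixes P :: "real poly poly"
  assumes monic: "lead_coeff P = 1"
  obtains A R where "P = A * R" "resultant A (pderiv A * R) \<noteq> 0"
    "\<And>b x. poly (specialize b R) x = 0 \<Longrightarrow> Polynomial.order x (specialize b P) \<noteq> 1"
proof -
  define M where "M = prime_factorization P"
  define A where "A = prod_mset (filter_mset (\<lambda>p. count M p = 1) M)"
  define R where "R = prod_mset (filter_mset (\<lambda>p. count M p \<noteq> 1) M)"
  have P0: "P \<noteq> 0" using monic by auto
  have norm: "normalize P = P" using monic
    by (simp add: normalize_poly_def unit_factor_poly_def)
  have "normalize (prod_mset N) = prod_mset N" if "\<And>p. p \<in># N \<Longrightarrow> prime p" for N :: "real poly poly multiset"
    using that
  proof (induction N)
    case (add p N)
    then have "prime p" "normalize (prod_mset N) = prod_mset N" by auto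
    then show ?case by (simp add: normalize_mult normalize_prime)
  qed simp
  from this[of "prime_factorization P"] have M: "prod_mset M = P"
    using prod_mset_prime_factorization_weak[OF P0] norm unfolding M_def
    by (simp add: in_prime_factors_imp_prime)
  have PAR: "P = A * R" unfolding A_def R_def M[symmetric]
    by (simp only: prod_mset.union[symmetric] multiset_partition[symmetric])
  have A0: "A \<noteq> 0" and R0: "R \<noteq> 0" using PAR P0 by auto
  have prime: "prime p" if "p \<in># M" for p using that unfolding M_def by auto
  have deg: "degree p > 0" if "p \<in># M" for p
  proof (rule ccontr)
    assume "\<not> degree p > 0"
    then obtain c where c: "p = [:c:]" using degree_eq_zeroE by blast
    have "p dvd P" using that unfolding M_def by auto
    then have "c dvd lead_coeff P" unfolding c const_poly_dvd_iff by blast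
    then have "c dvd 1" using monic by simp
    then have "is_unit p" using c by simp
    with prime[OF that] show False using not_prime_unit by blast
  qed
  have inM: "p \<in># M \<and> count M p = 1" if "prime p" "p dvd A" for p
  proof -
    from that obtain p' where p': "p' \<in># filter_mset (\<lambda>p. count M p = 1) M" "p dvd p'"
      unfolding A_def by (auto simp: prime_dvd_prod_mset_iff)
    then have "p' \<in># M" by auto
    then have "p = p'" using prime that p' by (intro primes_dvd_imp_eq) auto
    with p' show ?thesis by auto
  qed
  have inR: "count M p \<noteq> 1" if "prime p" "p dvd R" for p
  proof -
    from that obtain p' where p': "p' \<in># filter_mset (\<lambda>p. count M p \<noteq> 1) M" "p dvd p'"
      unfolding R_def by (auto simp: prime_dvd_prod_mset_iff)
    then have "p' \<in># M" by auto
    then have "p = p'" using prime that p' by (intro primes_dvd_imp_eq) auto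
    with p' show ?thesis by auto
  qed
  have res: "resultant A (pderiv A * R) \<noteq> 0"
  proof
    assume "resultant A (pderiv A * R) = 0"
    then have deg_gcd: "degree (gcd A (pderiv A * R)) \<noteq> 0" by (simp add: resultant_0_gcd)
    have gcd0: "gcd A (pderiv A * R) \<noteq> 0" using A0 by simp
    have "degree g = 0" if "is_unit g" for g :: "real poly poly"
      using that by (auto simp: is_unit_poly_iff)
    with deg_gcd have "\<not> is_unit (gcd A (pderiv A * R))" by auto
    from prime_divisor_exists[OF gcd0 this] obtain p
      where p: "prime p" "p dvd gcd A (pderiv A * R)" by auto
    then have pA: "p dvd A" and pR: "p dvd pderiv A * R" by auto
    from inM[OF p(1) pA] have pM: "p \<in># M" "count M p = 1" by auto
    from p(1) pR pM inR have pd: "p dvd pderiv A" by (metis prime_dvd_mult_iff)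
    obtain B where B: "A = p * B" using pA by blast
    have "A = p * prod_mset (filter_mset (\<lambda>p. count M p = 1) M - {#p#})"
      unfolding A_def using pM by (intro prod_mset.remove) simp
    then have B': "B = prod_mset (filter_mset (\<lambda>p. count M p = 1) M - {#p#})" using B A0 by auto
    have nB: "\<not> p dvd B"
    proof
      assume "p dvd B"
      then obtain p' where p': "p' \<in># filter_mset (\<lambda>p. count M p = 1) M - {#p#}" "p dvd p'"
        unfolding B' using p(1) by (auto simp: prime_dvd_prod_mset_iff)
      then have "p' \<in># filter_mset (\<lambda>p. count M p = 1) M" by (blast dest: in_diffD)
      then have "p' \<in># M" by simp
      then have "p = p'" using prime p(1) p' by (intro primes_dvd_imp_eq) auto
      with p' pM show False by (simp add: in_diff_count)
    qed
    have "pderiv A = pderiv p * B + p * pderiv B" unfolding B by (simp add: pderiv_mult algebra_simps)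
    with pd have "p dvd pderiv p * B" by (simp add: dvd_add_left_iff)
    with p(1) nB have "p dvd pderiv p" by (simp add: prime_dvd_mult_iff)
    with pderiv_prime_not_dvd[of p] p(1) deg[OF pM(1)] show False by auto
  qed
  have "Polynomial.order x (specialize b P) \<noteq> 1" if "poly (specialize b R) x = 0" for b x
  proof -
    from specialize_prod_mset_root[OF that[unfolded R_def]]
    obtain p where p: "p \<in># M" "count M p \<noteq> 1" "poly (specialize b p) x = 0" by auto
    have "count M p \<noteq> 0" using p(1) by simp
    with p(2) have "2 \<le> count M p" by linarith
    then have "replicate_mset 2 p \<subseteq># M" by (simp add: count_le_replicate_mset_subset_eq)
    then have "prod_mset (replicate_mset 2 p) dvd prod_mset M" by (rule prod_mset_subset_imp_dvd)
    then have "p^2 dvd P" by (simp add: M)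
    then have "specialize b (p^2) dvd specialize b P" by (rule specialize_dvd)
    then have "specialize b p ^ 2 dvd specialize b P" by (simp add: power2_eq_square specialize_mult)
    moreover have "[:-x, 1:] ^ 2 dvd specialize b p ^ 2"
      using p(3) by (simp add: poly_eq_0_iff_dvd dvd_power_same)
    ultimately have "[:-x, 1:] ^ 2 dvd specialize b P" by (meson dvd_trans)
    moreover have "specialize b P \<noteq> 0" using monic by (rule specialize_monic_nonzero)
    ultimately have "2 \<le> Polynomial.order x (specialize b P)" using order_divides[of x 2 "specialize b P"] by blast
    then show ?thesis by simp
  qed
  with that[OF PAR res] show ?thesis .
qed

text \<open>Resultants commute with specialization only if the degrees are preserved.\<close>

lemma degree_specialize:
  assumes "degree (lead_coeff p) = 0"
  shows "degree (specialize b p) = degree p"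
proof (cases "p = 0")
  case False
  then have "poly (lead_coeff p) b \<noteq> 0" using assms
    by (auto elim!: degree_eq_zeroE)
  then show ?thesis by (intro antisym degree_map_poly_le le_degree) (simp add: coeff_map_poly)
qed auto

text \<open>Away from the zeros of the resultant all roots of \<open>A\<close> are simple roots of \<open>P\<close>, and
  \<open>A\<close> has as many distinct roots as its degree, because \<open>P\<close> has only real ones. At \<open>b0\<close> every simple
  root is a root of \<open>A\<close>, so that this degree is at least \<open>k\<close>.\<close>

theorem finite_fewer_simple_roots:
  fixes P :: "real poly poly"
  assumes monic: "lead_coeff P = 1"
    and split: "\<And>b. size (proots (specialize b P)) = degree P"
    and k: "k \<le> card {x. Polynomial.order x (specialize b0 P) = 1}"
  shows "finite {b. card {x. Polynomial.order x (specialize b P) = 1} < k}"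
proof -
  obtain A R where PAR: "P = A * R" and res: "resultant A (pderiv A * R) \<noteq> 0"
    and mult: "\<And>b x. poly (specialize b R) x = 0 \<Longrightarrow> Polynomial.order x (specialize b P) \<noteq> 1"
    using simple_part_decomposition[OF monic] by blast
  have P0: "specialize b P \<noteq> 0" for b using monic by (rule specialize_monic_nonzero)
  have sP: "specialize b P = specialize b A * specialize b R" for b
    unfolding PAR by (rule specialize_mult)
  have A0: "specialize b A \<noteq> 0" and R0: "specialize b R \<noteq> 0" for b
    using P0[of b] sP[of b] by auto
  have lc: "lead_coeff A * lead_coeff R = 1" using monic unfolding PAR by (simp add: lead_coeff_mult)
  have uA: "is_unit (lead_coeff A)" by (rule dvdI[OF lc[symmetric]])
  have uR: "is_unit (lead_coeff R)"
    by (rule dvdI[of _ _ "lead_coeff A"]) (use lc in \<open>simp add: mult.commute\<close>)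
  have dl: "degree (lead_coeff A) = 0" "degree (lead_coeff R) = 0"
    using uA uR by (auto simp: is_unit_iff_degree)
  have dA: "degree (specialize b A) = degree A" and dR: "degree (specialize b R) = degree R" for b
    using dl degree_specialize by auto
  \<comment> \<open>At every parameter the simple roots sit in A; in particular at b0, where they are counted.\<close>
  have "{x. Polynomial.order x (specialize b0 P) = 1} \<subseteq> {x. poly (specialize b0 A) x = 0}"
  proof clarify
    fix x assume o: "Polynomial.order x (specialize b0 P) = 1"
    then have "poly (specialize b0 P) x = 0" using P0 by (simp add: order_root)
    moreover have "poly (specialize b0 R) x \<noteq> 0" using mult o by blast
    ultimately show "poly (specialize b0 A) x = 0" by (simp add: sP)
  qed
  then have "card {x. Polynomial.order x (specialize b0 P) = 1} \<le> card {x. poly (specialize b0 A) x = 0}"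
    by (intro card_mono poly_roots_finite A0)
  also have "\<dots> \<le> degree A" using card_poly_roots_bound[OF A0] dA by metis
  finally have kA: "k \<le> degree A" using k by simp
  have good: "k \<le> card {x. Polynomial.order x (specialize b P) = 1}"
    if b: "poly (resultant A (pderiv A * R)) b \<noteq> 0" for b
  proof (cases "degree A = 0")
    case False
    let ?a = "specialize b A" and ?r = "specialize b R"
    have dd: "degree (specialize b (pderiv A * R)) = degree (pderiv A * R)"
    proof (rule degree_specialize)
      have "lead_coeff (pderiv A) = of_nat (degree A) * lead_coeff A"
        using False by (simp add: coeff_pderiv degree_pderiv)
      also have "degree \<dots> = 0" using dl using degree_mult_le[of "of_nat (degree A)" "lead_coeff A"] by simp
      finally have "degree (lead_coeff (pderiv A)) = 0" .
      then show "degree (lead_coeff (pderiv A * R)) = 0"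
        using dl degree_mult_le[of "lead_coeff (pderiv A)" "lead_coeff R"] by (simp only: lead_coeff_mult)
    qed
    have "resultant ?a (specialize b (pderiv A * R)) = poly (resultant A (pderiv A * R)) b"
      by (rule poly_hom.resultant_map_poly) (use dA dd in auto)
    with b have "resultant ?a (pderiv ?a * ?r) \<noteq> 0" by (simp add: specialize_mult specialize_pderiv)
    then have g: "degree (gcd ?a (pderiv ?a * ?r)) = 0" by (simp add: resultant_0_gcd)
    have cop: "poly (pderiv ?a) x \<noteq> 0 \<and> poly ?r x \<noteq> 0" if "poly ?a x = 0" for x
    proof (rule ccontr)
      assume "\<not> ?thesis"
      then have "poly (pderiv ?a * ?r) x = 0" by auto
      then have "[:-x, 1:] dvd gcd ?a (pderiv ?a * ?r)" using that
        by (simp only: gcd_greatest_iff poly_eq_0_iff_dvd)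
      moreover have "gcd ?a (pderiv ?a * ?r) \<noteq> 0" using A0 by simp
      ultimately have "degree [:-x, 1:] \<le> degree (gcd ?a (pderiv ?a * ?r))"
        by (rule dvd_imp_degree_le)
      with g show False by simp
    qed
    have oA: "Polynomial.order x ?a = 1" if "poly ?a x = 0" for x
      using that cop[OF that] A0[of b] order_pderiv[of ?a x] by (simp add: order_root)
    have oP: "Polynomial.order x (specialize b P) = 1" if "poly ?a x = 0" for x
      using oA[OF that] cop[OF that] P0[of b] R0[of b] unfolding sP by (simp add: order_mult order_0I)
    \<comment> \<open>A product that splits into linear factors has only factors that split.\<close>
    have "size (proots ?a) + size (proots ?r) = degree ?a + degree ?r"
    proof -
      have "A \<noteq> 0" "R \<noteq> 0" using A0[of b] R0[of b] by auto
      then have "degree P = degree A + degree R" unfolding PAR by (rule degree_mult_eq)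
      moreover have "proots (specialize b P) = proots ?a + proots ?r"
        unfolding sP by (rule proots_mult[OF A0 R0])
      ultimately show ?thesis using split[of b] by (simp add: dA dR)
    qed
    with size_proots_le[of ?a] size_proots_le[of ?r] have "size (proots ?a) = degree A" using dA by simp
    moreover have "size (proots ?a) = card {x. poly ?a x = 0}"
    proof -
      have "size (proots ?a) = (\<Sum>x\<in>{x. poly ?a x = 0}. Polynomial.order x ?a)"
        using A0[of b] by (simp add: size_multiset_overloaded_eq)
      also have "\<dots> = card {x. poly ?a x = 0}" using oA by simp
      finally show ?thesis .
    qed
    ultimately have "degree A = card {x. poly ?a x = 0}" by simp
    also have "\<dots> \<le> card {x. Polynomial.order x (specialize b P) = 1}"
    proof (rule card_mono)
      have "{x. Polynomial.order x (specialize b P) = 1} \<subseteq> {x. poly (specialize b P) x = 0}"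
        using P0 by (auto simp: order_root)
      then show "finite {x. Polynomial.order x (specialize b P) = 1}"
        by (rule finite_subset) (rule poly_roots_finite[OF P0])
    qed (use oP in auto)
    finally show ?thesis using kA by simp
  qed (use kA in simp)
  have "{b. card {x. Polynomial.order x (specialize b P) = 1} < k} \<subseteq> {b. poly (resultant A (pderiv A * R)) b = 0}"
    using good by (auto simp: not_le[symmetric])
  then show ?thesis by (rule finite_subset) (rule poly_roots_finite[OF res])
qed

section \<open>Multiplicities for real symmetric matrices\<close>

lemma mult_mat_vec_sum:
  assumes "A \<in> carrier_mat n m" "x \<in> carrier_vec m" "i < n"
  shows "vec_index (A *\<^sub>v x) i = (\<Sum>j<m. A $$ (i,j) * vec_index x j)"
  using assms by (auto simp: mult_mat_vec_def scalar_prod_def lessThan_atLeast0 intro!: sum.cong)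

lemma symmetric_matD:
  assumes "A\<^sup>T = A" "A \<in> carrier_mat m m" "i < m" "j < m"
  shows "A $$ (i,j) = A $$ (j,i)"
  using assms by (metis carrier_matD index_transpose_mat(1))

text \<open>The Hermitian form \<open>S\<close> equals its own conjugate by symmetry, and equals \<open>a\<close> times the squared
  norm \<open>N\<close> of the eigenvector.\<close>

lemma symmetric_eigenvalue_real:
  fixes A :: "real mat"
  assumes A: "A \<in> carrier_mat m m" and sym: "A\<^sup>T = A"
    and ev: "eigenvalue (map_mat of_real A) (a :: complex)"
  shows "a \<in> \<real>"
proof -
  let ?A = "map_mat of_real A :: complex mat"
  have cA: "?A \<in> carrier_mat m m" using A by simp
  from ev obtain v where v: "v \<in> carrier_vec m" "v \<noteq> 0\<^sub>v m" "?A *\<^sub>v v = a \<cdot>\<^sub>v v"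
    unfolding eigenvalue_def eigenvector_def using A by auto
  define V where "V = vec_index v"
  define N where "N = (\<Sum>i<m. (cmod (V i))\<^sup>2)"
  define S where "S = (\<Sum>i<m. \<Sum>j<m. cnj (V i) * (of_real (A $$ (i,j)) * V j))"
  have eq: "(\<Sum>j<m. of_real (A $$ (i,j)) * V j) = a * V i" if "i < m" for i
  proof -
    have "(\<Sum>j<m. of_real (A $$ (i,j)) * V j) = vec_index (?A *\<^sub>v v) i"
      using A that v(1) unfolding V_def by (subst mult_mat_vec_sum[OF cA v(1) that]) (auto intro!: sum.cong)
    then show ?thesis using v that by (simp add: V_def)
  qed
  have "S = (\<Sum>i<m. cnj (V i) * (\<Sum>j<m. of_real (A $$ (i,j)) * V j))"
    unfolding S_def by (simp add: sum_distrib_left)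
  also have "\<dots> = (\<Sum>i<m. cnj (V i) * (a * V i))" using eq by (intro sum.cong) auto
  also have "\<dots> = a * of_real N"
    unfolding N_def of_real_sum sum_distrib_left
    by (intro sum.cong refl) (simp add: complex_norm_square ac_simps flip: of_real_power)
  finally have SN: "S = a * of_real N" .
  have "cnj S = (\<Sum>i<m. \<Sum>j<m. V i * (of_real (A $$ (i,j)) * cnj (V j)))"
    unfolding S_def by simp
  also have "\<dots> = (\<Sum>j<m. \<Sum>i<m. V i * (of_real (A $$ (i,j)) * cnj (V j)))" by (rule sum.swap)
  also have "\<dots> = S"
    unfolding S_def using symmetric_matD[OF sym A] by (intro sum.cong refl) (simp add: ac_simps)
  finally have "cnj a * of_real N = a * of_real N" unfolding SN by simp
  moreover have "N \<noteq> 0"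
  proof
    assume "N = 0"
    then have "\<forall>i<m. V i = 0" unfolding N_def by (subst (asm) sum_nonneg_eq_0_iff) auto
    then have "v = 0\<^sub>v m" using v(1) unfolding V_def by (intro eq_vecI) auto
    with v(2) show False by simp
  qed
  ultimately have "cnj a = a" by simp
  then show ?thesis by (simp add: Reals_cnj_iff)
qed

lemma symmetric_char_poly_split:
  fixes A :: "real mat"
  assumes A: "A \<in> carrier_mat m m" and sym: "A\<^sup>T = A"
  obtains es where "char_poly A = (\<Prod>e\<leftarrow>es. [:-e, 1:])" "length es = m"
proof -
  let ?A = "map_mat of_real A :: complex mat"
  have cA: "?A \<in> carrier_mat m m" using A by simp
  from char_poly_factorized[OF cA] obtain as where
    as: "char_poly ?A = (\<Prod>a\<leftarrow>as. [:-a, 1:])" "length as = m" by blast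
  have real: "a \<in> \<real>" if "a \<in> set as" for a
  proof (rule symmetric_eigenvalue_real[OF A sym])
    have "poly (char_poly ?A) a = 0" unfolding as using that
      by (simp add: poly_prod_list prod_list_zero_iff image_iff)
    then show "eigenvalue ?A a" by (simp add: eigenvalue_root_char_poly[OF cA])
  qed
  interpret of_real_poly: map_poly_inj_idom_hom "of_real :: real \<Rightarrow> complex" ..
  have "map of_real (map Re as) = as" using real
    by (simp add: o_def map_idI)
  then have "char_poly ?A = (\<Prod>e\<leftarrow>map Re as. [:- of_real e, 1:])"
    unfolding as by (metis (no_types, lifting) map_eq_conv map_map o_def)
  also have "\<dots> = map_poly of_real (\<Prod>e\<leftarrow>map Re as. [:-e, 1:])"
    by (simp add: of_real_poly.hom_prod_list o_def)
  finally have "map_poly of_real (char_poly A) = (map_poly of_real (\<Prod>e\<leftarrow>map Re as. [:-e, 1:]) :: complex poly)"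
    using of_real_hom.char_poly_hom[OF A, where ?'a = complex] by simp
  then have "char_poly A = (\<Prod>e\<leftarrow>map Re as. [:-e, 1:])" by (rule of_real_poly.injectivity)
  then show ?thesis using that[of "map Re as"] as(2) by simp
qed

lemma scalar_prod_self_eq_0:
  fixes x :: "real vec"
  assumes "x \<in> carrier_vec m" "scalar_prod x x = 0"
  shows "x = 0\<^sub>v m"
proof (rule eq_vecI)
  have "(\<Sum>i<m. vec_index x i * vec_index x i) = 0"
    using assms by (simp add: scalar_prod_def lessThan_atLeast0)
  then have "\<forall>i<m. vec_index x i * vec_index x i = 0"
    by (subst (asm) sum_nonneg_eq_0_iff) auto
  then show "\<And>i. i < dim_vec (0\<^sub>v m) \<Longrightarrow> vec_index x i = vec_index (0\<^sub>v m) i" by simp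
qed (use assms in auto)

text \<open>For symmetric matrices the algebraic multiplicity is at most the geometric one. A Schur triangulation
  that lists \<open>e\<close> first yields vectors \<open>x\<^sub>i\<close> with \<open>(A - e) x\<^sub>i\<close> in the span of the previous ones. Inductively
  \<open>(A - e)\<^sup>2 x\<^sub>i = 0\<close>, and symmetry gives \<open>(A - e) x\<^sub>i = 0\<close>. Independence is stated
  with coefficients, in the form in which it is refuted by explicit combinations.\<close>

lemma symmetric_eigenvectors:
  fixes A :: "real mat"
  assumes A: "A \<in> carrier_mat m m" and sym: "A\<^sup>T = A"
    and k: "k \<le> Polynomial.order e (char_poly A)"
  obtains x where "\<And>i. i < k \<Longrightarrow> x i \<in> carrier_vec m \<and> A *\<^sub>v x i = e \<cdot>\<^sub>v x i"
    "\<And>c. (\<And>a. a < m \<Longrightarrow> (\<Sum>i<k. c i * vec_index (x i) a) = 0) \<Longrightarrow> \<forall>i<k. c i = (0::real)"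
proof -
  obtain es where es: "char_poly A = (\<Prod>e\<leftarrow>es. [:-e, 1:])" "length es = m"
    using symmetric_char_poly_split[OF A sym] by blast
  \<comment> \<open>The Schur form can have the eigenvalues on its diagonal in any prescribed order.\<close>
  define fs where "fs = filter ((=) e) es @ filter (\<lambda>d. \<not> e = d) es"
  have mset: "mset fs = mset es" unfolding fs_def by simp
  have "prod_mset (mset (map (\<lambda>e. [:-e, 1:]) fs)) = prod_mset (mset (map (\<lambda>e. [:-e, 1:]) es))"
    by (simp only: mset_map mset)
  then have fs: "char_poly A = (\<Prod>e\<leftarrow>fs. [:-e, 1:])"
    unfolding es(1) by (simp only: prod_mset_prod_list)
  have "Polynomial.order e (char_poly A) = sum_list (map (\<lambda>d. Polynomial.order e [:-d, 1:]) es)"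
    unfolding es(1) by (subst order_prod_list) (auto simp: o_def)
  also have "\<dots> = length (filter ((=) e) es)"
    unfolding order_linear' neg_equal_iff_equal by (induction es) auto
  finally have kf: "k \<le> length (filter ((=) e) es)" using k by simp
  have lenfs: "length fs = m" using mset es(2) by (metis size_mset)
  have km: "k \<le> m" using kf es(2) length_filter_le[of "(=) e" es] by linarith
  have fse: "fs ! i = e" if "i < k" for i
  proof -
    have i: "i < length (filter ((=) e) es)" using that kf by simp
    then have "fs ! i = filter ((=) e) es ! i" unfolding fs_def by (simp add: nth_append)
    moreover have "filter ((=) e) es ! i \<in> set (filter ((=) e) es)" using i by (rule nth_mem)
    ultimately show ?thesis by simp
  qed
  obtain B P Q where schur: "schur_decomposition A fs = (B,P,Q)" by (cases "schur_decomposition A fs")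
  from schur_decomposition[OF A fs schur]
  have wit: "similar_mat_wit A B P Q" and ut: "upper_triangular B" and dg: "diag_mat B = fs" by auto
  from similar_mat_witD2[OF A wit] have B: "B \<in> carrier_mat m m" and P: "P \<in> carrier_mat m m"
    and Q: "Q \<in> carrier_mat m m" and QP: "Q * P = 1\<^sub>m m" and APB: "A = P * B * Q" by auto
  have AP: "A * P = P * B"
    unfolding APB using B P Q QP by (simp add: assoc_mult_mat[of _ m m _ m _ m])
  define x where "x = col P"
  have xc: "x i \<in> carrier_vec m" if "i < m" for i using P that unfolding x_def by auto
  have Ax: "A *\<^sub>v x i = P *\<^sub>v col B i" if "i < m" for i
    using that A P B AP unfolding x_def by (metis carrier_matD(2) col_mult2)
  have tri: "vec_index (A *\<^sub>v x i - e \<cdot>\<^sub>v x i) a = (\<Sum>l<i. B $$ (l,i) * vec_index (x l) a)"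
    if "i < k" "a < m" for i a
  proof -
    have im: "i < m" using that km by simp
    have "vec_index (A *\<^sub>v x i) a = (\<Sum>l<m. P $$ (a,l) * vec_index (col B i) l)"
      unfolding Ax[OF im] by (rule mult_mat_vec_sum[OF P _ that(2)]) (use B im in auto)
    also have "\<dots> = (\<Sum>l<m. P $$ (a,l) * B $$ (l,i))" using B im by (intro sum.cong) auto
    also have "\<dots> = (\<Sum>l<Suc i. P $$ (a,l) * B $$ (l,i))"
      using im ut B by (intro sum.mono_neutral_right) (auto simp: upper_triangular_def)
    also have "\<dots> = (\<Sum>l<i. P $$ (a,l) * B $$ (l,i)) + P $$ (a,i) * B $$ (i,i)" by simp
    also have "B $$ (i,i) = e" using fse[OF that(1)] B im unfolding dg[symmetric] diag_mat_def by simp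
    finally have "vec_index (A *\<^sub>v x i) a = (\<Sum>l<i. P $$ (a,l) * B $$ (l,i)) + P $$ (a,i) * e" .
    moreover have "P $$ (a,l) = vec_index (x l) a" if "l \<le> i" for l
      using that im P \<open>a < m\<close> unfolding x_def by auto
    ultimately show ?thesis using A P im that(2) xc[OF im] by (simp add: ac_simps)
  qed
  have eig: "A *\<^sub>v x i = e \<cdot>\<^sub>v x i" if "i < k" for i
    using that
  proof (induction i rule: less_induct)
    case (less i)
    then have im: "i < m" using km by simp
    define y where "y = A *\<^sub>v x i - e \<cdot>\<^sub>v x i"
    have yc: "y \<in> carrier_vec m" using A xc[OF im] unfolding y_def by auto
    have ya: "vec_index y a = (\<Sum>l<i. B $$ (l,i) * vec_index (x l) a)" if "a < m" for a
      using tri[OF less.prems that] unfolding y_def .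
    \<comment> \<open>y is a combination of the earlier vectors, which are eigenvectors by induction.\<close>
    have "A *\<^sub>v y = e \<cdot>\<^sub>v y"
    proof (rule eq_vecI)
      fix a assume "a < dim_vec (e \<cdot>\<^sub>v y)"
      then have a: "a < m" using yc by simp
      have "vec_index (A *\<^sub>v y) a = (\<Sum>j<m. A $$ (a,j) * (\<Sum>l<i. B $$ (l,i) * vec_index (x l) j))"
        using mult_mat_vec_sum[OF A yc a] ya by simp
      also have "\<dots> = (\<Sum>l<i. B $$ (l,i) * (\<Sum>j<m. A $$ (a,j) * vec_index (x l) j))"
        unfolding sum_distrib_left by (subst sum.swap) (simp add: ac_simps)
      also have "\<dots> = (\<Sum>l<i. B $$ (l,i) * (e * vec_index (x l) a))"
      proof (intro sum.cong refl)
        fix l assume "l \<in> {..<i}"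
        then have l: "l < i" "l < k" "l < m" using less.prems im by auto
        have "(\<Sum>j<m. A $$ (a,j) * vec_index (x l) j) = vec_index (A *\<^sub>v x l) a"
          using mult_mat_vec_sum[OF A xc[OF l(3)] a] by simp
        also have "\<dots> = e * vec_index (x l) a" using less.IH[OF l(1,2)] xc[OF l(3)] a by simp
        finally show "B $$ (l,i) * (\<Sum>j<m. A $$ (a,j) * vec_index (x l) j) = B $$ (l,i) * (e * vec_index (x l) a)" by simp
      qed
      also have "\<dots> = e * vec_index y a" using ya[OF a] by (simp add: sum_distrib_left ac_simps)
      finally show "vec_index (A *\<^sub>v y) a = vec_index (e \<cdot>\<^sub>v y) a" using a yc by simp
    qed (use A yc in auto)
    \<comment> \<open>By symmetry y is orthogonal to (A - e) x_i, that is, to itself.\<close>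
    moreover have "scalar_prod (A *\<^sub>v y) (x i) = scalar_prod y (A *\<^sub>v x i)"
      using transpose_vec_mult_scalar[OF A xc[OF im] yc] sym by simp
    ultimately have "scalar_prod y (A *\<^sub>v x i) - scalar_prod y (e \<cdot>\<^sub>v x i) = 0"
      using yc xc[OF im] by simp
    then have "scalar_prod y y = 0"
      using yc xc[OF im] A unfolding y_def
      by (metis (no_types, lifting) mult_mat_vec_carrier scalar_prod_minus_distrib smult_carrier_vec)
    then have "y = 0\<^sub>v m" by (rule scalar_prod_self_eq_0[OF yc])
    then have "vec_index (A *\<^sub>v x i) a = vec_index (e \<cdot>\<^sub>v x i) a" if "a < m" for a
      using that xc[OF im] A unfolding y_def
      by (metis (no_types, lifting) carrier_vecD eq_iff_diff_eq_0 index_minus_vec(1) index_smult_vec(2) index_zero_vec(1))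
    then show ?case using xc[OF im] A by (intro eq_vecI) auto
  qed
  have indep: "\<forall>i<k. c i = 0" if c: "\<And>a. a < m \<Longrightarrow> (\<Sum>i<k. c i * vec_index (x i) a) = 0" for c
  proof -
    define w where "w = vec m (\<lambda>i. if i < k then c i else 0)"
    have wc: "w \<in> carrier_vec m" unfolding w_def by simp
    have "P *\<^sub>v w = 0\<^sub>v m"
    proof (rule eq_vecI)
      fix a assume "a < dim_vec (0\<^sub>v m :: real vec)"
      then have a: "a < m" by simp
      have "vec_index (P *\<^sub>v w) a = (\<Sum>i<m. P $$ (a,i) * vec_index w i)" by (rule mult_mat_vec_sum[OF P wc a])
      also have "\<dots> = (\<Sum>i<k. P $$ (a,i) * vec_index w i)"
        using km by (intro sum.mono_neutral_right) (auto simp: w_def)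
      also have "\<dots> = (\<Sum>i<k. c i * vec_index (x i) a)"
        using km P a by (intro sum.cong) (auto simp: w_def x_def)
      finally show "vec_index (P *\<^sub>v w) a = vec_index (0\<^sub>v m) a" using c[OF a] a by simp
    qed (use P in auto)
    then have "Q *\<^sub>v (P *\<^sub>v w) = 0\<^sub>v m" using Q by auto
    then have "w = 0\<^sub>v m" using Q P wc QP by (metis assoc_mult_mat_vec one_mult_mat_vec)
    then show ?thesis using km unfolding w_def
      by (metis (mono_tags, lifting) index_vec index_zero_vec(1) order_less_le_trans)
  qed
  show ?thesis
  proof (rule that[of x])
    show "x i \<in> carrier_vec m \<and> A *\<^sub>v x i = e \<cdot>\<^sub>v x i" if "i < k" for i
      using xc eig km that by simp
  qed (use indep in blast)
qed

section \<open>The two halves and their Gershgorin discs\<close>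

definition diag_entry :: "nat \<Rightarrow> nat \<Rightarrow> real" where
  "diag_entry n k = q_of n + real k"

text \<open>The operator \<open>D + s S\<close>: the vertex \<open>0\<close> is joined to all others, and the additional edge
  between \<open>1\<close> and \<open>2\<close> closes the triangle. Vertices are numbered from \<open>0\<close>. The vertices from \<open>3\<close> on
  hang on \<open>0\<close> only and are called leaves.\<close>

definition arrow :: "nat \<Rightarrow> real \<Rightarrow> (nat \<Rightarrow> real) \<Rightarrow> nat \<Rightarrow> real" where
  "arrow n s u k = diag_entry n k * u k + s * (if k = 0 then (\<Sum>j\<in>{1..<n}. u j)
     else if k = 1 then u 2 - u 0 else if k = 2 then - u 0 - u 1 else - u 0)"

definition coupling :: "nat \<Rightarrow> nat \<Rightarrow> real" where
  "coupling n k = 2 * diag_entry n k / (q_of n)\<^sup>2"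

text \<open>The vector \<open>(u, v)\<close> satisfies the eigenvalue equation for \<open>e\<close> of the half with sign \<open>s\<close>; it may be
  zero.\<close>

definition half_eigenvector :: "nat \<Rightarrow> real \<Rightarrow> real \<Rightarrow> (nat \<Rightarrow> real) \<Rightarrow> (nat \<Rightarrow> real) \<Rightarrow> bool" where
  "half_eigenvector n s e u v \<longleftrightarrow> (\<forall>k<n.
     - arrow n (-s) (arrow n s u) k - coupling n k * v k = e * u k \<and>
     - (coupling n k * u k) - 2 * diag_entry n k * v k = e * v k)"

lemma q_of_eq: "q_of n = (real n)\<^sup>2 / 2 - 1"
  by (simp add: q_of_def power2_eq_square field_simps)

lemma q_of_ge: "n \<ge> 4 \<Longrightarrow> q_of n \<ge> 2 * real n - 1" 
proof -
  assume "n \<ge> 4"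
  then have "4 * real n \<le> real n * real n" by (intro mult_right_mono) auto
  then show ?thesis by (simp add: q_of_eq power2_eq_square)
qed

lemma q_of_ge_7: "n \<ge> 4 \<Longrightarrow> q_of n \<ge> 7"
  using q_of_ge[of n] by simp

lemma diag_entry_pos: "n \<ge> 4 \<Longrightarrow> diag_entry n k > 0"
  using q_of_ge_7[of n] by (simp add: diag_entry_def)

lemma coupling_bounds:
  assumes n: "n \<ge> 4" and k: "k < n"
  shows "0 < coupling n k" "coupling n k \<le> 1 / 2"
proof -
  let ?q = "q_of n"
  have q: "?q \<ge> 7" "real n \<le> (?q + 1) / 2" using q_of_ge_7[OF n] q_of_ge[OF n] by auto
  have kn: "real k \<le> real n - 1" using k by linarith
  have q2: "?q\<^sup>2 \<ge> 7 * ?q" using q by (simp add: power2_eq_square)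
  have "4 * real k \<le> 2 * ?q" using q(2) kn by (simp add: field_simps)
  then have "4 * diag_entry n k \<le> 7 * ?q" using q(1) unfolding diag_entry_def by simp
  with q2 have "4 * diag_entry n k \<le> ?q\<^sup>2" by linarith
  moreover have "?q\<^sup>2 > 0" using q by simp
  ultimately show "coupling n k \<le> 1 / 2" by (simp add: coupling_def field_simps)
  show "0 < coupling n k" using diag_entry_pos[OF n] \<open>?q\<^sup>2 > 0\<close> by (simp add: coupling_def)
qed

lemma sign_cases: "s * s = 1 \<Longrightarrow> s = 1 \<or> s = (-1::real)"
  by (simp add: square_eq_1_iff)

lemma sum_from_1:
  fixes f :: "nat \<Rightarrow> real"
  assumes "n \<ge> 4"
  shows "(\<Sum>j\<in>{1..<n}. f j) = f 1 + f 2 + (\<Sum>j\<in>{3..<n}. f j)"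
  using assms by (simp add: sum.atLeast_Suc_lessThan numeral_2_eq_2 numeral_3_eq_3)

lemma arrow_0:
  "n \<ge> 4 \<Longrightarrow> arrow n s u 0 = diag_entry n 0 * u 0 + s * (u 1 + u 2 + (\<Sum>j\<in>{3..<n}. u j))"
  by (simp only: arrow_def sum_from_1 HOL.simp_thms if_True)

lemma arrow_1: "arrow n s u 1 = diag_entry n 1 * u 1 + s * (u 2 - u 0)"
  by (simp add: arrow_def)

lemma arrow_2: "arrow n s u 2 = diag_entry n 2 * u 2 + s * (- u 0 - u 1)"
  by (simp add: arrow_def)

lemma arrow_leaf: "k \<ge> 3 \<Longrightarrow> arrow n s u k = diag_entry n k * u k + s * (- u 0)"
  by (simp add: arrow_def)

lemma diag_entry_1: "diag_entry n 1 = diag_entry n 0 + 1"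
  and diag_entry_2: "diag_entry n 2 = diag_entry n 0 + 2"
  by (auto simp: diag_entry_def)

text \<open>The rows of \<open>(D - s S)(D + s S)\<close>, split into the diagonal entry, which carries the centre of the Gershgorin disc,
  and a remainder. The first row contains the differences \<open>d\<^sub>j - d\<^sub>0 = j\<close>, which sum up to \<open>n (n - 1) / 2\<close>: its
  disc is the only one whose radius grows quadratically.\<close>

lemma arrow_arrow_0:
  assumes "n \<ge> 4" "s * s = 1"
  shows "arrow n (-s) (arrow n s u) 0 = ((diag_entry n 0)\<^sup>2 + (real n - 1)) * u 0
    - ((\<Sum>j\<in>{3..<n}. s * real j * u j) + (s - 1) * u 1 + (2 * s + 1) * u 2)"
proof -
  have "(\<Sum>j\<in>{3..<n}. arrow n s u j) = (\<Sum>j\<in>{3..<n}. diag_entry n j * u j - s * u 0)"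
    by (intro sum.cong) (auto simp: arrow_def)
  also have "\<dots> = (\<Sum>j\<in>{3..<n}. diag_entry n 0 * u j + real j * u j) - (real n - 3) * s * u 0"
    using assms by (simp add: sum_subtractf of_nat_diff diag_entry_def algebra_simps)
  also have "\<dots> = diag_entry n 0 * (\<Sum>j\<in>{3..<n}. u j) + (\<Sum>j\<in>{3..<n}. real j * u j) - (real n - 3) * s * u 0"
    by (simp add: sum.distrib sum_distrib_left)
  finally have L: "(\<Sum>j\<in>{3..<n}. arrow n s u j) = \<dots>" .
  have J: "(\<Sum>j\<in>{3..<n}. s * real j * u j) = s * (\<Sum>j\<in>{3..<n}. real j * u j)"
    by (simp add: sum_distrib_left mult.assoc)
  show ?thesis
    unfolding arrow_0[OF assms(1), of "-s"] L J arrow_0[OF assms(1)] arrow_1 arrow_2 diag_entry_1 diag_entry_2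
    using sign_cases[OF assms(2)] by (elim disjE) (simp_all add: algebra_simps power2_eq_square)
qed

lemma arrow_arrow_1:
  assumes "n \<ge> 4" "s * s = 1"
  shows "arrow n (-s) (arrow n s u) 1 = ((diag_entry n 1)\<^sup>2 + 2) * u 1
    + ((1 - s) * u 0 + (1 - s) * u 2 + (\<Sum>j\<in>{3..<n}. u j))"
  unfolding arrow_0[OF assms(1)] arrow_1 arrow_2 diag_entry_1 diag_entry_2
  using sign_cases[OF assms(2)] by (elim disjE) (simp_all add: algebra_simps power2_eq_square)

lemma arrow_arrow_2:
  assumes "n \<ge> 4" "s * s = 1"
  shows "arrow n (-s) (arrow n s u) 2 = (diag_entry n 2)\<^sup>2 * u 2
    + (- (2 * s + 1) * u 0 + (1 - s) * u 1 + 2 * u 2 + (\<Sum>j\<in>{3..<n}. u j))"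
  unfolding arrow_0[OF assms(1)] arrow_1 arrow_2 diag_entry_1 diag_entry_2
  using sign_cases[OF assms(2)] by (elim disjE) (simp_all add: algebra_simps power2_eq_square)

lemma arrow_arrow_leaf:
  assumes "n \<ge> 4" "s * s = 1" "k \<ge> 3"
  shows "arrow n (-s) (arrow n s u) k = (diag_entry n k)\<^sup>2 * u k
    + (- s * real k * u 0 + u 1 + u 2 + (\<Sum>j\<in>{3..<n}. u j))"
proof -
  have d: "diag_entry n k = diag_entry n 0 + real k" by (simp add: diag_entry_def)
  show ?thesis
    unfolding arrow_leaf[OF assms(3)] arrow_0[OF assms(1)] d
    using sign_cases[OF assms(2)] by (elim disjE) (simp_all add: algebra_simps power2_eq_square)
qed

text \<open>Row \<open>k\<close> of the upper block has the index \<open>(True, k)\<close>, that of the lower block \<open>(False, k)\<close>. All centres are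
  negative, and this is their absolute value. The corrections for \<open>k = 0\<close> and \<open>k = 1\<close> are the
  diagonal entries of \<open>- S\<^sup>2\<close>; for \<open>n = 4\<close> the first two discs are too close to count both of them in
  the radius, as is done with the diagonal entries for larger \<open>k\<close>.\<close>

definition disc_centre :: "nat \<Rightarrow> bool \<times> nat \<Rightarrow> real" where
  "disc_centre n i = (case i of (h, k) \<Rightarrow> if h then
     (diag_entry n k)\<^sup>2 + (if k = 0 then real n - 1 else if k = 1 then 2 else 0)
     else 2 * diag_entry n k)"

text \<open>The summand \<open>1 / 2\<close> bounds the coupling of the two blocks.\<close>

definition disc_radius :: "nat \<Rightarrow> bool \<times> nat \<Rightarrow> real" where
  "disc_radius n i = (case i of (h, k) \<Rightarrow> if h then
     (if k = 0 then real n * (real n - 1) / 2 else if k = 1 then real n + 1 else 2 * real n) + 1 / 2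
     else 1 / 2)"

definition component :: "(nat \<Rightarrow> real) \<Rightarrow> (nat \<Rightarrow> real) \<Rightarrow> bool \<times> nat \<Rightarrow> real" where
  "component u v i = (case i of (h, k) \<Rightarrow> if h then u k else v k)"

lemma abs_sum_le: 
  fixes f :: "nat \<Rightarrow> real"
  assumes "\<And>j. j \<in> S \<Longrightarrow> \<bar>f j\<bar> \<le> g j"
  shows "\<bar>\<Sum>j\<in>S. f j\<bar> \<le> (\<Sum>j\<in>S. g j)"
  using assms by (intro order_trans[OF sum_abs sum_mono])

lemma offdiagonal_bound:
  assumes n: "n \<ge> 4" and s: "s = 1 \<or> s = -1" and k: "k < n" and m: "\<And>i. i < n \<Longrightarrow> \<bar>u i\<bar> \<le> m"
  shows "\<bar>arrow n (-s) (arrow n s u) k - disc_centre n (True, k) * u k\<bar> \<le> (disc_radius n (True, k) - 1 / 2) * m"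
proof -
  have ss: "s * s = 1" using s by auto
  have m0: "m \<ge> 0" using m[of 0] n by linarith
  have b: "\<bar>u 0\<bar> \<le> m" "\<bar>u 1\<bar> \<le> m" "\<bar>u 2\<bar> \<le> m" using m n by auto
  have S: "\<bar>\<Sum>j\<in>{3..<n}. u j\<bar> \<le> (real n - 3) * m"
    using abs_sum_le[of "{3..<n}" u "\<lambda>_. m"] m n by (simp add: of_nat_diff)
  have J: "\<bar>\<Sum>j\<in>{3..<n}. s * real j * u j\<bar> \<le> (real n * (real n - 1) / 2 - 3) * m"
  proof -
    have "\<bar>\<Sum>j\<in>{3..<n}. s * real j * u j\<bar> \<le> (\<Sum>j\<in>{3..<n}. real j * m)"
      using m s by (intro abs_sum_le) (auto simp: abs_mult intro!: mult_left_mono)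
    also have "\<dots> = (\<Sum>j\<in>{3..<n}. real j) * m" by (simp add: sum_distrib_right)
    also have "(\<Sum>j\<in>{3..<n}. real j) = real n * (real n - 1) / 2 - 3" using n
    proof (induction n rule: dec_induct)
      case base
      have "{3..<4::nat} = {3}" by auto
      then show ?case by simp
    next
      case (step n)
      then show ?case by (simp add: field_simps)
    qed
    finally show ?thesis .
  qed
  consider "k = 0" | "k = 1" | "k = 2" | "k \<ge> 3" by linarith
  then show ?thesis
  proof cases
    case 1
    have "\<bar>(s - 1) * u 1 + (2 * s + 1) * u 2\<bar> \<le> 3 * m" using s b by (auto simp: abs_if split: if_splits)
    with J have "\<bar>(\<Sum>j\<in>{3..<n}. s * real j * u j) + ((s - 1) * u 1 + (2 * s + 1) * u 2)\<bar>
        \<le> (real n * (real n - 1) / 2 - 3) * m + 3 * m" by linarith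
    also have "\<dots> = (disc_radius n (True, k) - 1 / 2) * m" using 1 by (simp add: disc_radius_def algebra_simps)
    also have "(\<Sum>j\<in>{3..<n}. s * real j * u j) + ((s - 1) * u 1 + (2 * s + 1) * u 2)
        = - (arrow n (-s) (arrow n s u) k - disc_centre n (True, k) * u k)"
      using 1 arrow_arrow_0[OF n ss, of u] by (simp add: disc_centre_def)
    finally show ?thesis by simp
  next
    case 2
    have "\<bar>(1 - s) * u 0 + (1 - s) * u 2\<bar> \<le> 4 * m" using s b by (auto simp: abs_if split: if_splits)
    with S have "\<bar>(1 - s) * u 0 + (1 - s) * u 2 + (\<Sum>j\<in>{3..<n}. u j)\<bar> \<le> 4 * m + (real n - 3) * m" by linarith
    also have "\<dots> = (disc_radius n (True, k) - 1 / 2) * m" using 2 by (simp add: disc_radius_def algebra_simps)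
    also have "(1 - s) * u 0 + (1 - s) * u 2 + (\<Sum>j\<in>{3..<n}. u j)
        = arrow n (-s) (arrow n s u) k - disc_centre n (True, k) * u k"
      using 2 arrow_arrow_1[OF n ss, of u] by (simp add: disc_centre_def)
    finally show ?thesis .
  next
    case 3
    have "\<bar>- (2 * s + 1) * u 0 + (1 - s) * u 1 + 2 * u 2\<bar> \<le> 7 * m"
      using s b by (auto simp: abs_if split: if_splits)
    with S have "\<bar>- (2 * s + 1) * u 0 + (1 - s) * u 1 + 2 * u 2 + (\<Sum>j\<in>{3..<n}. u j)\<bar> \<le> 7 * m + (real n - 3) * m" by linarith
    also have "\<dots> \<le> (disc_radius n (True, k) - 1 / 2) * m"
    proof -
      have "real n * m \<ge> 4 * m" using n m0 by (intro mult_right_mono) auto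
      then show ?thesis using 3 by (simp add: disc_radius_def algebra_simps)
    qed
    also have "- (2 * s + 1) * u 0 + (1 - s) * u 1 + 2 * u 2 + (\<Sum>j\<in>{3..<n}. u j)
        = arrow n (-s) (arrow n s u) k - disc_centre n (True, k) * u k"
      using 3 arrow_arrow_2[OF n ss, of u] by (simp add: disc_centre_def)
    finally show ?thesis .
  next
    case 4
    have "\<bar>- s * real k * u 0\<bar> \<le> (real n - 1) * m"
    proof -
      have "\<bar>- s * real k * u 0\<bar> = real k * \<bar>u 0\<bar>" using s by (auto simp: abs_mult)
      also have "\<dots> \<le> (real n - 1) * m" using k b m0 by (intro mult_mono) auto
      finally show ?thesis .
    qed
    with S b have "\<bar>- s * real k * u 0 + u 1 + u 2 + (\<Sum>j\<in>{3..<n}. u j)\<bar> \<le> (real n - 1) * m + 2 * m + (real n - 3) * m" by linarith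
    also have "\<dots> \<le> (disc_radius n (True, k) - 1 / 2) * m"
      using 4 m0 by (simp add: disc_radius_def algebra_simps)
    also have "- s * real k * u 0 + u 1 + u 2 + (\<Sum>j\<in>{3..<n}. u j)
        = arrow n (-s) (arrow n s u) k - disc_centre n (True, k) * u k"
      using 4 arrow_arrow_leaf[OF n ss 4, of u] by (simp add: disc_centre_def)
    finally show ?thesis .
  qed
qed

text \<open>Gershgorin's argument at the entry of largest modulus; that this entry does not vanish is recorded, since
  it is what yields one-dimensional eigenspaces.\<close>

lemma eigenvalue_in_disc:
  assumes n: "n \<ge> 4" and s: "s = 1 \<or> s = -1" and ev: "half_eigenvector n s e u v"
    and nz: "\<exists>i\<in>UNIV \<times> {..<n}. component u v i \<noteq> 0"
  obtains i where "i \<in> UNIV \<times> {..<n}" "component u v i \<noteq> 0" "\<bar>e + disc_centre n i\<bar> \<le> disc_radius n i"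
proof -
  let ?I = "UNIV \<times> {..<n} :: (bool \<times> nat) set"
  define m where "m = Max ((\<lambda>i. \<bar>component u v i\<bar>) ` ?I)"
  have fin: "finite ?I" by simp
  have ne: "?I \<noteq> {}" using n by (auto simp: lessThan_empty_iff)
  have "m \<in> (\<lambda>i. \<bar>component u v i\<bar>) ` ?I" unfolding m_def using fin ne by (intro Max_in) auto
  then obtain i where i: "i \<in> ?I" "\<bar>component u v i\<bar> = m" by auto
  have le: "\<bar>component u v j\<bar> \<le> m" if "j \<in> ?I" for j
    unfolding m_def using fin that by (intro Max_ge) auto
  have mpos: "m > 0" using nz le by fastforce
  obtain h k where hk: "i = (h, k)" by (cases i)
  have k: "k < n" using i hk by auto
  have lu: "\<bar>u j\<bar> \<le> m" and lv: "\<bar>v j\<bar> \<le> m" if "j < n" for j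
    using le[of "(True, j)"] le[of "(False, j)"] that by (auto simp: component_def)
  note cb = coupling_bounds[OF n k]
  have "\<bar>e + disc_centre n i\<bar> * m \<le> disc_radius n i * m"
  proof (cases h)
    case True
    then have um: "\<bar>u k\<bar> = m" using i hk by (simp add: component_def)
    have eq: "(e + disc_centre n i) * u k = - (arrow n (-s) (arrow n s u) k - disc_centre n (True, k) * u k) - coupling n k * v k"
      using ev k True hk unfolding half_eigenvector_def by (auto simp: algebra_simps)
    have "\<bar>coupling n k\<bar> * \<bar>v k\<bar> \<le> 1 / 2 * m" using cb lv[OF k] by (intro mult_mono) auto
    then have "\<bar>coupling n k * v k\<bar> \<le> 1 / 2 * m" by (simp only: abs_mult)
    with eq offdiagonal_bound[OF n s k, of u m, OF lu]
    have "\<bar>(e + disc_centre n i) * u k\<bar> \<le> (disc_radius n (True, k) - 1 / 2) * m + 1 / 2 * m" by linarith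
    then have "\<bar>e + disc_centre n i\<bar> * \<bar>u k\<bar> \<le> disc_radius n (True, k) * m"
      unfolding abs_mult by (simp add: algebra_simps)
    then show ?thesis using um True hk by simp
  next
    case False
    then have vm: "\<bar>v k\<bar> = m" using i hk by (simp add: component_def)
    have "(e + disc_centre n i) * v k = - (coupling n k * u k)"
      using ev k False hk unfolding half_eigenvector_def disc_centre_def by (auto simp: algebra_simps)
    moreover have "\<bar>coupling n k\<bar> * \<bar>u k\<bar> \<le> 1 / 2 * m" using cb lu[OF k] by (intro mult_mono) auto
    then have "\<bar>coupling n k * u k\<bar> \<le> 1 / 2 * m" by (simp only: abs_mult)
    ultimately have "\<bar>(e + disc_centre n i) * v k\<bar> \<le> 1 / 2 * m" by simp
    then show ?thesis using vm False hk by (simp add: abs_mult disc_radius_def)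
  qed
  then have "\<bar>e + disc_centre n i\<bar> \<le> disc_radius n i" using mpos by simp
  moreover have "component u v i \<noteq> 0" using i mpos by auto
  ultimately show ?thesis using that i by blast
qed

text \<open>Consecutive squares \<open>(q + k)\<^sup>2\<close> are at least \<open>2 q + 1 = n\<^sup>2 - 1\<close> apart, which leaves
  room for two radii of the upper block, of total size at most \<open>n (n - 1) / 2 + O(n)\<close>. The lower block has discs of
  radius \<open>1 / 2\<close> at distance \<open>2\<close>, far from those of the upper block, since \<open>2 q\<close> is small
  against \<open>q\<^sup>2\<close>.\<close>

lemma discs_disjoint:
  assumes n: "n \<ge> 4" and i: "i \<in> UNIV \<times> {..<n}" and j: "j \<in> UNIV \<times> {..<n}" and ne: "i \<noteq> j"
    and e: "\<bar>e + disc_centre n i\<bar> \<le> disc_radius n i" "\<bar>e + disc_centre n j\<bar> \<le> disc_radius n j"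
  shows False
proof -
  define N where "N = real n"
  define M where "M = N * N"
  have N: "N \<ge> 4" unfolding N_def using n by simp
  have NM: "M \<ge> 4 * N" unfolding M_def using N by simp
  define q where "q = q_of n"
  have q: "q = M / 2 - 1" unfolding q_def N_def M_def q_of_eq by (simp add: power2_eq_square)
  have q7: "q \<ge> 7" unfolding q_def by (rule q_of_ge_7[OF n])
  define D where "D k = (diag_entry n k)\<^sup>2" for k
  have d: "diag_entry n k = q + real k" for k unfolding q_def diag_entry_def by simp
  have D0: "D 0 \<ge> 7 * q" unfolding D_def d using q7 by (simp add: power2_eq_square)
  have R: "real n * (real n - 1) / 2 = M / 2 - N / 2" unfolding N_def M_def by (simp add: field_simps)
  have gap: "D b - D a \<ge> 2 * q + real a + real b" if "a < b" for a b
  proof -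
    have "1 * (2 * q + real a + real b) \<le> (real b - real a) * (2 * q + real a + real b)"
      using that q7 by (intro mult_right_mono) auto
    then show ?thesis unfolding D_def d by (simp add: power2_eq_square algebra_simps)
  qed
  have gap0: "D b - D 0 \<ge> 4 * q" if "b \<ge> 2" for b
  proof -
    have "2 * (2 * q) \<le> real b * (2 * q + real b)" using that q7 by (intro mult_mono) auto
    then show ?thesis unfolding D_def d by (simp add: power2_eq_square algebra_simps)
  qed
  have centre: "disc_centre n (True, 0) = D 0 + (N - 1)" "disc_centre n (True, 1) = D 1 + 2"
    "k \<ge> 2 \<Longrightarrow> disc_centre n (True, k) = D k" "disc_centre n (False, k) = 2 * q + 2 * real k" for k
    by (simp_all add: disc_centre_def D_def N_def d)
  have radius: "disc_radius n (True, 0) = M / 2 - N / 2 + 1 / 2" "disc_radius n (True, 1) = N + 3 / 2"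
    "k \<ge> 2 \<Longrightarrow> disc_radius n (True, k) = 2 * N + 1 / 2" "disc_radius n (False, k) = 1 / 2" for k
    by (simp_all add: disc_radius_def N_def R)
  have outer: False if ab: "a < b" and
    da: "\<bar>e + disc_centre n (True, a)\<bar> \<le> disc_radius n (True, a)" and
    db: "\<bar>e + disc_centre n (True, b)\<bar> \<le> disc_radius n (True, b)" for a b
  proof -
    consider "a = 0" "b = 1" | "a = 0" "b \<ge> 2" | "a = 1" "b \<ge> 2" | "a \<ge> 2" "b \<ge> 3" using ab by linarith
    then show False
    proof cases
      case 1
      have "\<bar>e + (D 0 + (N - 1))\<bar> \<le> M / 2 - N / 2 + 1 / 2" "\<bar>e + (D 1 + 2)\<bar> \<le> N + 3 / 2"
        using da db 1 centre radius by simp_all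
      moreover have "D 1 - D 0 \<ge> 2 * q + 1" using gap[of 0 1] by simp
      ultimately show False using q N NM by linarith
    next
      case 2
      have "\<bar>e + (D 0 + (N - 1))\<bar> \<le> M / 2 - N / 2 + 1 / 2" "\<bar>e + D b\<bar> \<le> 2 * N + 1 / 2"
        using da db 2 centre radius by simp_all
      with gap0[OF 2(2)] q N NM show False by linarith
    next
      case 3
      have "\<bar>e + (D 1 + 2)\<bar> \<le> N + 3 / 2" "\<bar>e + D b\<bar> \<le> 2 * N + 1 / 2"
        using da db 3 centre radius by simp_all
      moreover have "real a = 1" "real b \<ge> 2" using 3 by auto
      ultimately show False using gap[OF ab] q N NM 3(1) by simp
    next
      case 4
      have "\<bar>e + D a\<bar> \<le> 2 * N + 1 / 2" "\<bar>e + D b\<bar> \<le> 2 * N + 1 / 2"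
        using da db 4 centre radius by simp_all
      moreover have "real a \<ge> 2" "real b \<ge> 3" using 4 by auto
      ultimately show False using gap[OF ab] q N NM by linarith
    qed
  qed
  have mixed: False if k: "k < n" and l: "l < n"
    and dk: "\<bar>e + disc_centre n (True, k)\<bar> \<le> disc_radius n (True, k)"
    and dl: "\<bar>e + disc_centre n (False, l)\<bar> \<le> disc_radius n (False, l)" for k l
  proof -
    have le: "\<bar>e + (2 * q + 2 * real l)\<bar> \<le> 1 / 2" using dl centre radius by simp
    have l': "real l \<le> N - 1" using l unfolding N_def by linarith
    consider "k = 0" | "k = 1" | "k \<ge> 2" by linarith
    then show False
    proof cases
      case 1
      then have "\<bar>e + (D 0 + (N - 1))\<bar> \<le> M / 2 - N / 2 + 1 / 2" using dk centre radius by simp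
      with le l' D0 q N NM show False by linarith
    next
      case 2
      then have "\<bar>e + (D 1 + 2)\<bar> \<le> N + 3 / 2" using dk centre radius by simp
      moreover have "D 1 - D 0 \<ge> 2 * q + 1" using gap[of 0 1] by simp
      ultimately show False using le l' D0 q N NM by linarith
    next
      case 3
      then have "\<bar>e + D k\<bar> \<le> 2 * N + 1 / 2" using dk centre radius by simp
      with le l' D0 gap0[OF 3] q N NM show False by linarith
    qed
  qed
  have inner: False if "k < l"
    "\<bar>e + disc_centre n (False, k)\<bar> \<le> disc_radius n (False, k)"
    "\<bar>e + disc_centre n (False, l)\<bar> \<le> disc_radius n (False, l)" for k l
  proof -
    have "real k + 1 \<le> real l" using that(1) by linarith
    with that(2,3) show False unfolding centre radius by linarith
  qed
  obtain g k h l where gh: "i = (g, k)" "j = (h, l)" by (cases i, cases j)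
  have "k < n" "l < n" using i j gh by auto
  then show False using e ne outer[of k l] outer[of l k] mixed[of k l] mixed[of l k] inner[of k l] inner[of l k]
    unfolding gh by (cases g; cases h; cases k l rule: linorder_cases) auto
qed

lemma zero_not_in_disc:
  assumes n: "n \<ge> 4" and i: "i \<in> UNIV \<times> {..<n}"
  shows "disc_radius n i < \<bar>disc_centre n i\<bar>"
proof -
  obtain h k where hk: "i = (h, k)" by (cases i)
  have NM: "real n * real n \<ge> 4 * real n" using n by simp
  have q: "q_of n = real n * real n / 2 - 1" by (simp add: q_of_eq power2_eq_square)
  have q7: "q_of n \<ge> 7" by (rule q_of_ge_7[OF n])
  have "q_of n * 7 \<le> diag_entry n k * diag_entry n k"
    using q7 unfolding diag_entry_def by (intro mult_mono) auto
  then have D: "7 * q_of n \<le> (diag_entry n k)\<^sup>2" by (simp add: power2_eq_square)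
  have d: "diag_entry n k \<ge> 7" using q7 by (simp add: diag_entry_def)
  have R: "real n * (real n - 1) / 2 = real n * real n / 2 - real n / 2" by (simp add: field_simps)
  have "disc_radius n i < disc_centre n i"
  proof (cases h)
    case True
    consider "k = 0" | "k = 1" | "k \<ge> 2" by linarith
    then show ?thesis
    proof cases
      case 1
      have "real n * real n / 2 - real n / 2 + 1 / 2 < (diag_entry n k)\<^sup>2 + (real n - 1)"
        using D q NM n by linarith
      then show ?thesis using 1 True by (simp add: hk disc_radius_def disc_centre_def R)
    next
      case 2
      have "real n + 1 + 1 / 2 < (diag_entry n k)\<^sup>2 + 2" using D q NM n by linarith
      then show ?thesis using 2 True by (simp add: hk disc_radius_def disc_centre_def)
    next
      case 3
      have "2 * real n + 1 / 2 < (diag_entry n k)\<^sup>2" using D q NM n by linarith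
      then show ?thesis using 3 True by (simp add: hk disc_radius_def disc_centre_def)
    qed
  next
    case False
    then show ?thesis using d by (simp add: hk disc_radius_def disc_centre_def)
  qed
  then show ?thesis by linarith
qed

text \<open>An eigenvalue lies in only one disc, and by Gershgorin's argument the entry belonging to it cannot vanish. Hence
  one linear functional, the same for both signs, is injective on the eigenspaces of both halves.\<close>

lemma pivot_component:
  assumes n: "n \<ge> 4"
  shows "\<exists>i\<in>UNIV \<times> {..<n}. \<forall>s u v k. (s = 1 \<or> s = -1) \<longrightarrow> half_eigenvector n s e u v \<longrightarrow>
    component u v i = 0 \<longrightarrow> k < n \<longrightarrow> u k = 0 \<and> v k = 0"
proof -
  let ?I = "UNIV \<times> {..<n}"
  obtain i where i: "i \<in> ?I" and
    disc: "(\<exists>j\<in>?I. \<bar>e + disc_centre n j\<bar> \<le> disc_radius n j) \<longrightarrow> \<bar>e + disc_centre n i\<bar> \<le> disc_radius n i"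
  proof (cases "\<exists>j\<in>?I. \<bar>e + disc_centre n j\<bar> \<le> disc_radius n j")
    case False
    moreover have "(True, 0) \<in> ?I" using n by simp
    ultimately show ?thesis using that by blast
  qed (use that in blast)
  have "u k = 0 \<and> v k = 0" if s: "s = 1 \<or> s = -1" and ev: "half_eigenvector n s e u v"
    and z: "component u v i = 0" and k: "k < n" for s u v k
  proof -
    have all: "\<not> (\<exists>j\<in>?I. component u v j \<noteq> 0)"
    proof
      assume "\<exists>j\<in>?I. component u v j \<noteq> 0"
      from eigenvalue_in_disc[OF n s ev this] obtain j where
        j: "j \<in> ?I" "component u v j \<noteq> 0" "\<bar>e + disc_centre n j\<bar> \<le> disc_radius n j" by blast
      then have "\<bar>e + disc_centre n i\<bar> \<le> disc_radius n i" "i \<noteq> j" using disc z by auto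
      from discs_disjoint[OF n i j(1) this(2,1) j(3)] show False .
    qed
    then have "component u v (True, k) = 0" "component u v (False, k) = 0" using k by auto
    then show ?thesis by (simp add: component_def)
  qed
  with i show ?thesis by blast
qed

section \<open>Reduction of a half to the triangle\<close>

definition det3 :: "real \<Rightarrow> real \<Rightarrow> real \<Rightarrow> real \<Rightarrow> real \<Rightarrow> real \<Rightarrow> real \<Rightarrow> real \<Rightarrow> real \<Rightarrow> real" where
  "det3 a1 a2 a3 b1 b2 b3 c1 c2 c3 =
     a1 * (b2 * c3 - b3 * c2) - a2 * (b1 * c3 - b3 * c1) + a3 * (b1 * c2 - b2 * c1)"

lemma det3_kernel:
  assumes "a1 * x + a2 * y + a3 * z = 0" "b1 * x + b2 * y + b3 * z = 0" "c1 * x + c2 * y + c3 * z = 0"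
    and nz: "x \<noteq> 0 \<or> y \<noteq> 0 \<or> z \<noteq> 0"
  shows "det3 a1 a2 a3 b1 b2 b3 c1 c2 c3 = 0"
proof -
  let ?D = "det3 a1 a2 a3 b1 b2 b3 c1 c2 c3"
  have "?D * x = (b2 * c3 - b3 * c2) * (a1 * x + a2 * y + a3 * z)
      - (a2 * c3 - a3 * c2) * (b1 * x + b2 * y + b3 * z) + (a2 * b3 - a3 * b2) * (c1 * x + c2 * y + c3 * z)"
    unfolding det3_def by (simp add: algebra_simps)
  moreover have "?D * y = - (b1 * c3 - b3 * c1) * (a1 * x + a2 * y + a3 * z)
      + (a1 * c3 - a3 * c1) * (b1 * x + b2 * y + b3 * z) - (a1 * b3 - a3 * b1) * (c1 * x + c2 * y + c3 * z)"
    unfolding det3_def by (simp add: algebra_simps)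
  moreover have "?D * z = (b1 * c2 - b2 * c1) * (a1 * x + a2 * y + a3 * z)
      - (a1 * c2 - a2 * c1) * (b1 * x + b2 * y + b3 * z) + (a1 * b2 - a2 * b1) * (c1 * x + c2 * y + c3 * z)"
    unfolding det3_def by (simp add: algebra_simps)
  ultimately show ?thesis using assms by auto
qed

text \<open>Laplace expansion along the first row of the matrix whose rows are listed.\<close>

definition det4 :: "real \<Rightarrow> real \<Rightarrow> real \<Rightarrow> real \<Rightarrow> real \<Rightarrow> real \<Rightarrow> real \<Rightarrow> real \<Rightarrow> real \<Rightarrow> real \<Rightarrow> real \<Rightarrow> real
   \<Rightarrow> real \<Rightarrow> real \<Rightarrow> real \<Rightarrow> real \<Rightarrow> real" where
  "det4 a1 a2 a3 a4 b1 b2 b3 b4 c1 c2 c3 c4 f1 f2 f3 f4 =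
     a1 * det3 b2 b3 b4 c2 c3 c4 f2 f3 f4 - a2 * det3 b1 b3 b4 c1 c3 c4 f1 f3 f4
     + a3 * det3 b1 b2 b4 c1 c2 c4 f1 f2 f4 - a4 * det3 b1 b2 b3 c1 c2 c3 f1 f2 f3"

lemma det4_kernel:
  assumes "a1 * x + a2 * y + a3 * z + a4 * w = 0" "b1 * x + b2 * y + b3 * z + b4 * w = 0"
    "c1 * x + c2 * y + c3 * z + c4 * w = 0" "f1 * x + f2 * y + f3 * z + f4 * w = 0"
    and nz: "x \<noteq> 0 \<or> y \<noteq> 0 \<or> z \<noteq> 0 \<or> w \<noteq> 0"
  shows "det4 a1 a2 a3 a4 b1 b2 b3 b4 c1 c2 c3 c4 f1 f2 f3 f4 = 0"
proof -
  let ?D = "det4 a1 a2 a3 a4 b1 b2 b3 b4 c1 c2 c3 c4 f1 f2 f3 f4"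
  let ?a = "a1 * x + a2 * y + a3 * z + a4 * w" and ?b = "b1 * x + b2 * y + b3 * z + b4 * w"
  let ?c = "c1 * x + c2 * y + c3 * z + c4 * w" and ?f = "f1 * x + f2 * y + f3 * z + f4 * w"
  have "?D * x = det3 b2 b3 b4 c2 c3 c4 f2 f3 f4 * ?a - det3 a2 a3 a4 c2 c3 c4 f2 f3 f4 * ?b
      + det3 a2 a3 a4 b2 b3 b4 f2 f3 f4 * ?c - det3 a2 a3 a4 b2 b3 b4 c2 c3 c4 * ?f"
    unfolding det3_def det4_def by (simp add: algebra_simps)
  moreover have "?D * y = - det3 b1 b3 b4 c1 c3 c4 f1 f3 f4 * ?a + det3 a1 a3 a4 c1 c3 c4 f1 f3 f4 * ?b
      - det3 a1 a3 a4 b1 b3 b4 f1 f3 f4 * ?c + det3 a1 a3 a4 b1 b3 b4 c1 c3 c4 * ?f"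
    unfolding det3_def det4_def by (simp add: algebra_simps)
  moreover have "?D * z = det3 b1 b2 b4 c1 c2 c4 f1 f2 f4 * ?a - det3 a1 a2 a4 c1 c2 c4 f1 f2 f4 * ?b
      + det3 a1 a2 a4 b1 b2 b4 f1 f2 f4 * ?c - det3 a1 a2 a4 b1 b2 b4 c1 c2 c4 * ?f"
    unfolding det3_def det4_def by (simp add: algebra_simps)
  moreover have "?D * w = - det3 b1 b2 b3 c1 c2 c3 f1 f2 f3 * ?a + det3 a1 a2 a3 c1 c2 c3 f1 f2 f3 * ?b
      - det3 a1 a2 a3 b1 b2 b3 f1 f2 f3 * ?c + det3 a1 a2 a3 b1 b2 b3 c1 c2 c3 * ?f"
    unfolding det3_def det4_def by (simp add: algebra_simps)
  ultimately show ?thesis using assms by auto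
qed

definition shift :: "nat \<Rightarrow> real \<Rightarrow> nat \<Rightarrow> real" where
  "shift n e k = e + 2 * diag_entry n k"

text \<open>Eliminating \<open>v\<^sub>k\<close> adds \<open>- c\<^sub>k\<^sup>2 / (e + 2 d\<^sub>k)\<close> to \<open>e\<close> on the diagonal. All equations are multiplied by
  \<open>shift\<close> so that they remain meaningful when \<open>e = - 2 d\<^sub>k\<close>.\<close>

definition eff :: "nat \<Rightarrow> real \<Rightarrow> nat \<Rightarrow> real" where
  "eff n e k = e * shift n e k - (coupling n k)\<^sup>2"

text \<open>The characteristic polynomial of a leaf that is detached from the vertex \<open>0\<close>.\<close>

definition leaf_poly :: "nat \<Rightarrow> real \<Rightarrow> nat \<Rightarrow> real" where
  "leaf_poly n e k = shift n e k * (e + (diag_entry n k)\<^sup>2) - (coupling n k)\<^sup>2"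

lemma leaf_poly_eff: "leaf_poly n e k = eff n e k + shift n e k * (diag_entry n k)\<^sup>2"
  by (simp add: leaf_poly_def eff_def algebra_simps)

lemma eliminate_lower_half:
  assumes "half_eigenvector n s e u v" "k < n"
  shows "eff n e k * u k + shift n e k * arrow n (-s) (arrow n s u) k = 0"
proof -
  have 1: "arrow n (-s) (arrow n s u) k = - e * u k - coupling n k * v k"
    and 2: "coupling n k * u k + (e + 2 * diag_entry n k) * v k = 0"
    using assms unfolding half_eigenvector_def by (auto simp: algebra_simps)
  have "eff n e k * u k + shift n e k * arrow n (-s) (arrow n s u) k
      = - coupling n k * (coupling n k * u k + (e + 2 * diag_entry n k) * v k)"
    unfolding eff_def shift_def 1 by (simp add: algebra_simps power2_eq_square)
  then show ?thesis unfolding 2 by simp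
qed

text \<open>A leaf is determined by \<open>u\<^sub>0\<close> and \<open>w\<^sub>0\<close>, where \<open>w = (D + s S) u\<close>, unless
  \<open>leaf_poly\<close> vanishes.\<close>

lemma leaf_relation:
  assumes n: "n \<ge> 4" and s: "s * s = 1" and ev: "half_eigenvector n s e u v" and k: "3 \<le> k" "k < n"
  shows "leaf_poly n e k * u k = s * shift n e k * (diag_entry n k * u 0 - arrow n s u 0)"
proof -
  have "arrow n (-s) (arrow n s u) k = diag_entry n k * (diag_entry n k * u k - s * u 0) + s * arrow n s u 0"
    unfolding arrow_leaf[OF k(1)] by simp
  with eliminate_lower_half[OF ev k(2)] show ?thesis
    unfolding leaf_poly_eff by (simp add: algebra_simps power2_eq_square)
qed

lemma upper_half_zero:
  assumes n: "n \<ge> 4" and ev: "half_eigenvector n s e u v" and u: "\<And>k. k < n \<Longrightarrow> u k = 0" and k: "k < n"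
  shows "v k = 0"
proof -
  have zero: "arrow n t x l = 0" if "\<And>i. i < n \<Longrightarrow> x i = 0" "l < n" for t x l
    using that n by (auto simp: arrow_def)
  have "arrow n (-s) (arrow n s u) k = 0" by (intro zero u k) auto
  then have "coupling n k * v k = 0" using ev k u unfolding half_eigenvector_def by fastforce
  then show ?thesis using coupling_bounds[OF n k] by simp
qed

text \<open>The determinant of the linear system for \<open>u\<^sub>0, w\<^sub>0, u\<^sub>1, u\<^sub>2\<close> that is left after the elimination of
  the leaves. The leaves enter only through the three sums \<open>\<sigma>\<close> and their number \<open>m\<close>.\<close>

definition core_det :: "real \<Rightarrow> real \<Rightarrow> real \<Rightarrow> real \<Rightarrow> real \<Rightarrow> real \<Rightarrow> real \<Rightarrow> real \<Rightarrow> real \<Rightarrow> real \<Rightarrow> real \<Rightarrow> real \<Rightarrow> real \<Rightarrow> real \<Rightarrow> real" where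
  "core_det s A0 r0 d0 A1 r1 d1 A2 r2 d2 \<sigma>0 \<sigma>1 \<sigma>2 m = det4
     (d0 + \<sigma>1) (- (1 + \<sigma>0)) s s
     (A0 + r0 * (2 - \<sigma>2 + m)) (r0 * (d0 + \<sigma>1)) (r0 * (1 - s * d1)) (r0 * (- 1 - s * d2))
     (r1 * (1 - s * d1)) (r1 * s) (A1 + r1 * (d1\<^sup>2 + 1)) (r1 * s * (d1 - d2))
     (r2 * (- 1 - s * d2)) (r2 * s) (r2 * s * (d1 - d2)) (A2 + r2 * (d2\<^sup>2 + 1))"

text \<open>The heart of the matter. For each vertex the triple \<open>(eff, shift * d, shift)\<close> stands for a symmetric
  \<open>2 \<times> 2\<close> matrix, and the part of the determinant odd in \<open>s\<close> is the invariant trilinear alternating form of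
  the three triples at the triangle; the leaves merely change the triple at the vertex \<open>0\<close>.\<close>

lemma core_det_odd_part:
  "core_det 1 A0 r0 d0 A1 r1 d1 A2 r2 d2 \<sigma>0 \<sigma>1 \<sigma>2 m - core_det (-1) A0 r0 d0 A1 r1 d1 A2 r2 d2 \<sigma>0 \<sigma>1 \<sigma>2 m
   = - 4 * det3 (A0 + r0 * (m - \<sigma>2)) (r0 * (d0 + \<sigma>1)) (r0 * (1 + \<sigma>0)) A1 (r1 * d1) r1 A2 (r2 * d2) r2"
  unfolding core_det_def det4_def det3_def by (simp add: algebra_simps power2_eq_square)

lemma core_det_zero:
  assumes n: "n \<ge> 4" and s: "s * s = 1" and ev: "half_eigenvector n s e u v"
    and nz: "k0 < n" "u k0 \<noteq> 0 \<or> v k0 \<noteq> 0"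
    and p: "\<And>j. 3 \<le> j \<Longrightarrow> j < n \<Longrightarrow> leaf_poly n e j \<noteq> 0"
  shows "core_det s (eff n e 0) (shift n e 0) (diag_entry n 0) (eff n e 1) (shift n e 1) (diag_entry n 1)
     (eff n e 2) (shift n e 2) (diag_entry n 2)
     (\<Sum>j\<in>{3..<n}. shift n e j / leaf_poly n e j)
     (\<Sum>j\<in>{3..<n}. shift n e j * diag_entry n j / leaf_poly n e j)
     (\<Sum>j\<in>{3..<n}. shift n e j * (diag_entry n j)\<^sup>2 / leaf_poly n e j) (real n - 3) = 0"
proof -
  let ?d = "diag_entry n" and ?A = "eff n e" and ?r = "shift n e" and ?p = "leaf_poly n e"
  define \<sigma>0 where "\<sigma>0 = (\<Sum>j\<in>{3..<n}. ?r j / ?p j)"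
  define \<sigma>1 where "\<sigma>1 = (\<Sum>j\<in>{3..<n}. ?r j * ?d j / ?p j)"
  define \<sigma>2 where "\<sigma>2 = (\<Sum>j\<in>{3..<n}. ?r j * (?d j)\<^sup>2 / ?p j)"
  define w where "w = arrow n s u"
  have leaf: "u j = s * (?r j * ?d j / ?p j * u 0 - ?r j / ?p j * w 0)" if "3 \<le> j" "j < n" for j
    using leaf_relation[OF n s ev that] p[OF that] unfolding w_def[symmetric] by (simp add: field_simps)
  have S: "(\<Sum>j\<in>{3..<n}. u j) = s * (\<sigma>1 * u 0 - \<sigma>0 * w 0)"
  proof -
    have "(\<Sum>j\<in>{3..<n}. u j) = (\<Sum>j\<in>{3..<n}. s * (?r j * ?d j / ?p j * u 0 - ?r j / ?p j * w 0))"
      using leaf by (intro sum.cong) auto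
    then show ?thesis unfolding \<sigma>0_def \<sigma>1_def
      by (simp only: sum_distrib_left[symmetric] sum_distrib_right[symmetric] sum_subtractf)
  qed
  have SD: "(\<Sum>j\<in>{3..<n}. ?d j * u j) = s * (\<sigma>2 * u 0 - \<sigma>1 * w 0)"
  proof -
    have "(\<Sum>j\<in>{3..<n}. ?d j * u j) = (\<Sum>j\<in>{3..<n}. s * (?r j * (?d j)\<^sup>2 / ?p j * u 0 - ?r j * ?d j / ?p j * w 0))"
    proof (intro sum.cong refl)
      fix j assume "j \<in> {3..<n}"
      then have uj: "u j = s * (?r j * ?d j / ?p j * u 0 - ?r j / ?p j * w 0)" using leaf by auto
      show "?d j * u j = s * (?r j * (?d j)\<^sup>2 / ?p j * u 0 - ?r j * ?d j / ?p j * w 0)"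
        unfolding uj by (simp add: algebra_simps power2_eq_square)
    qed
    then show ?thesis unfolding \<sigma>1_def \<sigma>2_def
      by (simp only: sum_distrib_left[symmetric] sum_distrib_right[symmetric] sum_subtractf)
  qed
  have SW: "(\<Sum>j\<in>{3..<n}. w j) = s * (\<sigma>2 * u 0 - \<sigma>1 * w 0) - (real n - 3) * s * u 0"
  proof -
    have "(\<Sum>j\<in>{3..<n}. w j) = (\<Sum>j\<in>{3..<n}. ?d j * u j - s * u 0)"
      unfolding w_def by (intro sum.cong) (auto simp: arrow_leaf)
    also have "\<dots> = (\<Sum>j\<in>{3..<n}. ?d j * u j) - (real n - 3) * s * u 0"
      using n by (simp add: sum_subtractf of_nat_diff algebra_simps)
    finally show ?thesis unfolding SD .
  qed
  have w0: "w 0 = ?d 0 * u 0 + s * (u 1 + u 2 + s * (\<sigma>1 * u 0 - \<sigma>0 * w 0))"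
    unfolding S[symmetric] unfolding w_def by (rule arrow_0[OF n])
  have w1: "w 1 = ?d 1 * u 1 + s * (u 2 - u 0)" unfolding w_def by (rule arrow_1)
  have w2: "w 2 = ?d 2 * u 2 + s * (- u 0 - u 1)" unfolding w_def by (rule arrow_2)
  have t0: "?A 0 * u 0 + ?r 0 * (?d 0 * w 0 + - s * (w 1 + w 2 + (\<Sum>j\<in>{3..<n}. w j))) = 0"
    using eliminate_lower_half[OF ev, of 0] n unfolding arrow_0[OF n, of "-s"] w_def by simp
  have t1: "?A 1 * u 1 + ?r 1 * (?d 1 * w 1 + - s * (w 2 - w 0)) = 0"
    using eliminate_lower_half[OF ev, of 1] n unfolding arrow_1[of n "-s"] w_def by simp
  have t2: "?A 2 * u 2 + ?r 2 * (?d 2 * w 2 + - s * (- w 0 - w 1)) = 0"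
    using eliminate_lower_half[OF ev, of 2] n unfolding arrow_2[of n "-s"] w_def by simp
  \<comment> \<open>If the four unknowns vanish, so do the leaves, and then the whole eigenvector.\<close>
  have "u 0 \<noteq> 0 \<or> w 0 \<noteq> 0 \<or> u 1 \<noteq> 0 \<or> u 2 \<noteq> 0"
  proof (rule ccontr)
    assume z: "\<not> ?thesis"
    have "u k = 0" if "k < n" for k
    proof -
      consider "k = 0" | "k = 1" | "k = 2" | "k \<ge> 3" by linarith
      then show ?thesis using z leaf[of k] that by cases auto
    qed
    with upper_half_zero[OF n ev this] nz show False by blast
  qed
  moreover have "(?d 0 + \<sigma>1) * u 0 + (- (1 + \<sigma>0)) * w 0 + s * u 1 + s * u 2 = 0"
    using w0 sign_cases[OF s] by (elim disjE) (simp_all add: algebra_simps)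
  moreover have "(?A 0 + ?r 0 * (2 - \<sigma>2 + (real n - 3))) * u 0 + ?r 0 * (?d 0 + \<sigma>1) * w 0
      + ?r 0 * (1 - s * ?d 1) * u 1 + ?r 0 * (- 1 - s * ?d 2) * u 2 = 0"
    using t0 sign_cases[OF s] unfolding SW w1 w2 by (elim disjE) (simp_all add: algebra_simps)
  moreover have "?r 1 * (1 - s * ?d 1) * u 0 + ?r 1 * s * w 0 + (?A 1 + ?r 1 * ((?d 1)\<^sup>2 + 1)) * u 1
      + ?r 1 * s * (?d 1 - ?d 2) * u 2 = 0"
    using t1 sign_cases[OF s] unfolding w1 w2 by (elim disjE) (simp_all add: algebra_simps power2_eq_square)
  moreover have "?r 2 * (- 1 - s * ?d 2) * u 0 + ?r 2 * s * w 0 + ?r 2 * s * (?d 1 - ?d 2) * u 1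
      + (?A 2 + ?r 2 * ((?d 2)\<^sup>2 + 1)) * u 2 = 0"
    using t2 sign_cases[OF s] unfolding w1 w2 by (elim disjE) (simp_all add: algebra_simps power2_eq_square)
  ultimately show ?thesis unfolding core_det_def \<sigma>0_def[symmetric] \<sigma>1_def[symmetric] \<sigma>2_def[symmetric]
    by (intro det4_kernel) auto
qed


text \<open>When \<open>leaf_poly\<close> vanishes at one leaf \<open>m\<close>, this leaf forces \<open>w\<^sub>0 = d\<^sub>m u\<^sub>0\<close> and its own value becomes
  free. The system for \<open>u\<^sub>0, u\<^sub>1, u\<^sub>2\<close> is what remains; \<open>dm\<close> is \<open>d\<^sub>m\<close>, and the sums run over the
  other leaves.\<close>

definition degenerate_core_det :: "real \<Rightarrow> real \<Rightarrow> real \<Rightarrow> real \<Rightarrow> real \<Rightarrow> real \<Rightarrow> real \<Rightarrow> real \<Rightarrow> real \<Rightarrow> real \<Rightarrow> real \<Rightarrow> real \<Rightarrow> real \<Rightarrow> real \<Rightarrow> real \<Rightarrow> real" where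
  "degenerate_core_det s A0 r0 d0 A1 r1 d1 A2 r2 d2 dm \<sigma>0 \<sigma>1 \<sigma>2 m = det3
     (A0 + r0 * (2 + m + dm * d0 - (\<sigma>2 - dm * \<sigma>1) - dm * (dm - d0 - (\<sigma>1 - dm * \<sigma>0))))
     (r0 * (1 - s * d1 + dm * s)) (r0 * (- 1 - s * d2 + dm * s))
     (r1 * (1 - s * d1 + s * dm)) (A1 + r1 * (d1\<^sup>2 + 1)) (r1 * s * (d1 - d2))
     (r2 * (- 1 - s * d2 + s * dm)) (r2 * s * (d1 - d2)) (A2 + r2 * (d2\<^sup>2 + 1))"

lemma degenerate_core_det_odd_part:
  "degenerate_core_det 1 A0 r0 d0 A1 r1 d1 A2 r2 d2 dm \<sigma>0 \<sigma>1 \<sigma>2 m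
   - degenerate_core_det (-1) A0 r0 d0 A1 r1 d1 A2 r2 d2 dm \<sigma>0 \<sigma>1 \<sigma>2 m
   = - 4 * r0 * det3 (- dm\<^sup>2) dm 1 A1 (r1 * d1) r1 A2 (r2 * d2) r2"
  unfolding degenerate_core_det_def det3_def by (simp add: algebra_simps power2_eq_square)

text \<open>The definition of \<open>w\<^sub>0\<close> serves to express the free value \<open>u\<^sub>m\<close> instead of \<open>w\<^sub>0\<close>.\<close>

lemma degenerate_core_det_zero:
  assumes n: "n \<ge> 4" and s: "s * s = 1" and ev: "half_eigenvector n s e u v"
    and nz: "k0 < n" "u k0 \<noteq> 0 \<or> v k0 \<noteq> 0"
    and m: "3 \<le> m" "m < n" "leaf_poly n e m = 0" "shift n e m \<noteq> 0"
    and p: "\<And>j. 3 \<le> j \<Longrightarrow> j < n \<Longrightarrow> j \<noteq> m \<Longrightarrow> leaf_poly n e j \<noteq> 0"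
  shows "degenerate_core_det s (eff n e 0) (shift n e 0) (diag_entry n 0) (eff n e 1) (shift n e 1) (diag_entry n 1)
     (eff n e 2) (shift n e 2) (diag_entry n 2) (diag_entry n m)
     (\<Sum>j\<in>{3..<n} - {m}. shift n e j / leaf_poly n e j)
     (\<Sum>j\<in>{3..<n} - {m}. shift n e j * diag_entry n j / leaf_poly n e j)
     (\<Sum>j\<in>{3..<n} - {m}. shift n e j * (diag_entry n j)\<^sup>2 / leaf_poly n e j) (real n - 3) = 0"
proof -
  let ?d = "diag_entry n" and ?A = "eff n e" and ?r = "shift n e" and ?p = "leaf_poly n e"
  let ?J = "{3..<n} - {m}"
  define \<sigma>0 where "\<sigma>0 = (\<Sum>j\<in>?J. ?r j / ?p j)"
  define \<sigma>1 where "\<sigma>1 = (\<Sum>j\<in>?J. ?r j * ?d j / ?p j)"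
  define \<sigma>2 where "\<sigma>2 = (\<Sum>j\<in>?J. ?r j * (?d j)\<^sup>2 / ?p j)"
  define w where "w = arrow n s u"
  have split: "(\<Sum>j\<in>{3..<n}. f j) = f m + (\<Sum>j\<in>?J. f j)" for f :: "nat \<Rightarrow> real"
    using m by (intro sum.remove) auto
  \<comment> \<open>The leaf relation at m has the left-hand side 0, and its factor shift is nonzero.\<close>
  have wm: "w 0 = ?d m * u 0"
    using leaf_relation[OF n s ev m(1,2)] m(3,4) sign_cases[OF s] unfolding w_def by auto
  have leaf: "u j = s * (?r j * ?d j / ?p j * u 0 - ?r j / ?p j * (?d m * u 0))" if "j \<in> ?J" for j
    using leaf_relation[OF n s ev, of j] p[of j] that unfolding w_def[symmetric] wm by (simp add: field_simps)
  have S: "(\<Sum>j\<in>?J. u j) = s * (\<sigma>1 * u 0 - \<sigma>0 * (?d m * u 0))"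
  proof -
    have "(\<Sum>j\<in>?J. u j) = (\<Sum>j\<in>?J. s * (?r j * ?d j / ?p j * u 0 - ?r j / ?p j * (?d m * u 0)))"
      using leaf by (intro sum.cong refl)
    then show ?thesis unfolding \<sigma>0_def \<sigma>1_def
      by (simp only: sum_distrib_left[symmetric] sum_distrib_right[symmetric] sum_subtractf)
  qed
  have SD: "(\<Sum>j\<in>?J. ?d j * u j) = s * (\<sigma>2 * u 0 - \<sigma>1 * (?d m * u 0))"
  proof -
    have "(\<Sum>j\<in>?J. ?d j * u j) = (\<Sum>j\<in>?J. s * (?r j * (?d j)\<^sup>2 / ?p j * u 0 - ?r j * ?d j / ?p j * (?d m * u 0)))"
    proof (intro sum.cong refl)
      fix j assume j: "j \<in> ?J"
      show "?d j * u j = s * (?r j * (?d j)\<^sup>2 / ?p j * u 0 - ?r j * ?d j / ?p j * (?d m * u 0))"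
        unfolding leaf[OF j] by (simp add: algebra_simps power2_eq_square)
    qed
    then show ?thesis unfolding \<sigma>1_def \<sigma>2_def
      by (simp only: sum_distrib_left[symmetric] sum_distrib_right[symmetric] sum_subtractf)
  qed
  have SW: "(\<Sum>j\<in>{3..<n}. w j) = ?d m * u m + s * (\<sigma>2 * u 0 - \<sigma>1 * (?d m * u 0)) - (real n - 3) * s * u 0"
  proof -
    have "(\<Sum>j\<in>{3..<n}. w j) = (\<Sum>j\<in>{3..<n}. ?d j * u j - s * u 0)"
      unfolding w_def by (intro sum.cong) (auto simp: arrow_leaf)
    also have "\<dots> = (\<Sum>j\<in>{3..<n}. ?d j * u j) - (real n - 3) * s * u 0"
      using n by (simp add: sum_subtractf of_nat_diff algebra_simps)
    finally show ?thesis unfolding split SD by simp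
  qed
  have "w 0 = ?d 0 * u 0 + s * (u 1 + u 2 + (u m + s * (\<sigma>1 * u 0 - \<sigma>0 * (?d m * u 0))))"
    unfolding S[symmetric] split[symmetric] unfolding w_def by (rule arrow_0[OF n])
  then have um: "u m = s * (?d m * u 0 - ?d 0 * u 0) - u 1 - u 2 - s * (\<sigma>1 * u 0 - \<sigma>0 * (?d m * u 0))"
    using sign_cases[OF s] unfolding wm by (elim disjE) simp_all
  have w1: "w 1 = ?d 1 * u 1 + s * (u 2 - u 0)" unfolding w_def by (rule arrow_1)
  have w2: "w 2 = ?d 2 * u 2 + s * (- u 0 - u 1)" unfolding w_def by (rule arrow_2)
  have t0: "?A 0 * u 0 + ?r 0 * (?d 0 * w 0 + - s * (w 1 + w 2 + (\<Sum>j\<in>{3..<n}. w j))) = 0"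
    using eliminate_lower_half[OF ev, of 0] n unfolding arrow_0[OF n, of "-s"] w_def by simp
  have t1: "?A 1 * u 1 + ?r 1 * (?d 1 * w 1 + - s * (w 2 - w 0)) = 0"
    using eliminate_lower_half[OF ev, of 1] n unfolding arrow_1[of n "-s"] w_def by simp
  have t2: "?A 2 * u 2 + ?r 2 * (?d 2 * w 2 + - s * (- w 0 - w 1)) = 0"
    using eliminate_lower_half[OF ev, of 2] n unfolding arrow_2[of n "-s"] w_def by simp
  have "u 0 \<noteq> 0 \<or> u 1 \<noteq> 0 \<or> u 2 \<noteq> 0"
  proof (rule ccontr)
    assume z: "\<not> ?thesis"
    have "u k = 0" if kn: "k < n" for k
    proof -
      consider "k = 0" | "k = 1" | "k = 2" | "k = m" | "k \<in> ?J"
        using kn by (cases "k \<ge> 3") (auto simp: not_le numeral_3_eq_3 numeral_2_eq_2 less_Suc_eq)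
      then show ?thesis using z leaf[of k] um by cases auto
    qed
    with upper_half_zero[OF n ev this] nz show False by blast
  qed
  moreover have "(?A 0 + ?r 0 * (2 + (real n - 3) + ?d m * ?d 0 - (\<sigma>2 - ?d m * \<sigma>1)
        - ?d m * (?d m - ?d 0 - (\<sigma>1 - ?d m * \<sigma>0)))) * u 0
      + ?r 0 * (1 - s * ?d 1 + ?d m * s) * u 1 + ?r 0 * (- 1 - s * ?d 2 + ?d m * s) * u 2 = 0"
    using t0 sign_cases[OF s] unfolding SW w1 w2 um wm by (elim disjE) (simp_all add: algebra_simps)
  moreover have "?r 1 * (1 - s * ?d 1 + s * ?d m) * u 0 + (?A 1 + ?r 1 * ((?d 1)\<^sup>2 + 1)) * u 1
      + ?r 1 * s * (?d 1 - ?d 2) * u 2 = 0"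
    using t1 sign_cases[OF s] unfolding w1 w2 wm by (elim disjE) (simp_all add: algebra_simps power2_eq_square)
  moreover have "?r 2 * (- 1 - s * ?d 2 + s * ?d m) * u 0 + ?r 2 * s * (?d 1 - ?d 2) * u 1
      + (?A 2 + ?r 2 * ((?d 2)\<^sup>2 + 1)) * u 2 = 0"
    using t2 sign_cases[OF s] unfolding w1 w2 wm by (elim disjE) (simp_all add: algebra_simps power2_eq_square)
  ultimately show ?thesis
    unfolding degenerate_core_det_def \<sigma>0_def[symmetric] \<sigma>1_def[symmetric] \<sigma>2_def[symmetric]
    by (intro det3_kernel) auto
qed

section \<open>Common eigenvalues of the two halves\<close>

abbreviation pencil_det :: "nat \<Rightarrow> real \<Rightarrow> real \<Rightarrow> real \<Rightarrow> real \<Rightarrow> real" where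
  "pencil_det n e a b c \<equiv> det3 a b c
     (eff n e 1) (shift n e 1 * diag_entry n 1) (shift n e 1) (eff n e 2) (shift n e 2 * diag_entry n 2) (shift n e 2)"

lemma pencil_det_linear:
  "pencil_det n e (a + a') (b + b') (c + c') = pencil_det n e a b c + pencil_det n e a' b' c'"
  "pencil_det n e (t * a) (t * b) (t * c) = t * pencil_det n e a b c"
  by (simp_all add: det3_def algebra_simps)

lemma pencil_det_sum:
  "pencil_det n e (\<Sum>j\<in>J. a j) (\<Sum>j\<in>J. b j) (\<Sum>j\<in>J. c j) = (\<Sum>j\<in>J. pencil_det n e (a j) (b j) (c j))"
proof (induction J rule: infinite_finite_induct)
  case (insert x J)
  then show ?case by (simp only: sum.insert pencil_det_linear insert.IH not_False_eq_True)
qed (simp_all add: det3_def)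

text \<open>In the first column the row of a vertex is \<open>e\<close> times the third column minus a multiple of \<open>d\<^sub>k\<^sup>2\<close>; with
  \<open>shift = e + 2 d\<^sub>k\<close>, column operations reduce the determinant to a multiple of \<open>e\<^sup>2\<close> times that of the rows
  \<open>(d\<^sub>k\<^sup>2, d\<^sub>k, 1)\<close>, a Vandermonde determinant. It is nonzero for \<open>k = 0\<close> and for the leaves.\<close>

lemma pencil_det_vertex:
  "pencil_det n e (eff n e k) (shift n e k * diag_entry n k) (shift n e k)
     = 4 / (q_of n) ^ 4 * e\<^sup>2 * ((real k - 1) * (real k - 2))"
proof -
  define g where "g = 4 / (q_of n) ^ 4"
  have c: "(coupling n k)\<^sup>2 = g * (diag_entry n k)\<^sup>2" for k
    unfolding coupling_def g_def by (simp add: power_divide power_mult_distrib flip: power_mult)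
  have d: "diag_entry n 1 = diag_entry n k - (real k - 1)" "diag_entry n 2 = diag_entry n k - (real k - 2)"
    by (simp_all add: diag_entry_def)
  show ?thesis unfolding g_def[symmetric] eff_def shift_def c d det3_def
    by (simp add: algebra_simps power2_eq_square)
qed

text \<open>The product of the two distances is the square of the coupling, which is at most \<open>1 / 4\<close>.\<close>

lemma leaf_poly_zero_location:
  assumes n: "n \<ge> 4" and j: "j < n" and z: "leaf_poly n e j = 0"
  shows "\<bar>e + 2 * diag_entry n j\<bar> \<le> 1 / 2 \<or> \<bar>e + (diag_entry n j)\<^sup>2\<bar> \<le> 1 / 2"
proof (rule ccontr)
  assume "\<not> ?thesis"
  then have "(1 / 2) * (1 / 2) < \<bar>e + 2 * diag_entry n j\<bar> * \<bar>e + (diag_entry n j)\<^sup>2\<bar>"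
    by (intro mult_strict_mono) auto
  moreover have "\<bar>e + 2 * diag_entry n j\<bar> * \<bar>e + (diag_entry n j)\<^sup>2\<bar> = (coupling n j)\<^sup>2"
    using z unfolding leaf_poly_def shift_def by (simp flip: abs_mult)
  moreover have "coupling n j * coupling n j \<le> (1 / 2) * (1 / 2)"
    using coupling_bounds[OF n j] by (intro mult_mono) auto
  ultimately show False by (simp add: power2_eq_square)
qed

lemma locations_apart:
  assumes n: "n \<ge> 4" and j: "j < n" and m: "m < n" "j \<noteq> m"
    and ej: "\<bar>e + 2 * diag_entry n j\<bar> \<le> 1 / 2 \<or> \<bar>e + (diag_entry n j)\<^sup>2\<bar> \<le> 1 / 2"
    and em: "\<bar>e + 2 * diag_entry n m\<bar> \<le> 1 / 2 \<or> \<bar>e + (diag_entry n m)\<^sup>2\<bar> \<le> 1 / 2"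
  shows False
proof -
  have q7: "q_of n \<ge> 7" by (rule q_of_ge_7[OF n])
  have qn: "q_of n \<ge> 2 * real n - 1" by (rule q_of_ge[OF n])
  have big: "(diag_entry n k)\<^sup>2 \<ge> 7 * q_of n" for k
  proof -
    have "q_of n * 7 \<le> diag_entry n k * diag_entry n k"
      using q7 unfolding diag_entry_def by (intro mult_mono) auto
    then show ?thesis by (simp add: power2_eq_square)
  qed
  have small: "2 * diag_entry n k \<le> 3 * q_of n" if "k < n" for k
    using that qn unfolding diag_entry_def by simp
  have lin: "\<bar>diag_entry n j - diag_entry n m\<bar> \<ge> 1" using m(2) unfolding diag_entry_def by simp
  have sq: "\<bar>(diag_entry n j)\<^sup>2 - (diag_entry n m)\<^sup>2\<bar> \<ge> 1 * 2"
  proof -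
    have "1 * 2 \<le> \<bar>diag_entry n j - diag_entry n m\<bar> * \<bar>diag_entry n j + diag_entry n m\<bar>"
      using lin q7 by (intro mult_mono) (auto simp: diag_entry_def)
    also have "\<dots> = \<bar>(diag_entry n j)\<^sup>2 - (diag_entry n m)\<^sup>2\<bar>"
      by (simp add: algebra_simps power2_eq_square flip: abs_mult)
    finally show ?thesis .
  qed
  show False using ej em lin sq big[of j] big[of m] small[OF j] small[OF m(1)] q7 by linarith
qed

text \<open>For a common eigenvalue the reduced determinants of both signs vanish, hence also their odd part, which
  is linear in the triple at the vertex \<open>0\<close>. If a single leaf polynomial vanished, the odd part would be a nonzero Vandermonde
  term; two of them, or one together with \<open>shift\<close> at the vertex \<open>0\<close>, cannot vanish at once.\<close>

lemma common_eigenvalue_equation: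
  assumes n: "n \<ge> 4"
    and p: "half_eigenvector n 1 e u v" "k < n" "u k \<noteq> 0 \<or> v k \<noteq> 0"
    and q: "half_eigenvector n (-1) e u' v'" "k' < n" "u' k' \<noteq> 0 \<or> v' k' \<noteq> 0"
  shows "(\<forall>j\<in>{3..<n}. leaf_poly n e j \<noteq> 0) \<and>
    2 + shift n e 0 * (\<Sum>j\<in>{3..<n}. (real j - 1) * (real j - 2) / leaf_poly n e j) = 0"
proof -
  have "\<exists>i\<in>UNIV \<times> {..<n}. component u v i \<noteq> 0"
  proof (cases "u k = 0")
    case True
    with p show ?thesis by (intro bexI[of _ "(False, k)"]) (auto simp: component_def)
  next
    case False
    with p show ?thesis by (intro bexI[of _ "(True, k)"]) (auto simp: component_def)
  qed
  from eigenvalue_in_disc[OF n _ p(1) this] obtain i where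
    i: "i \<in> UNIV \<times> {..<n}" "\<bar>e + disc_centre n i\<bar> \<le> disc_radius n i" by blast
  have e0: "e \<noteq> 0" using zero_not_in_disc[OF n i(1)] i(2) by auto
  have q7: "q_of n \<ge> 7" by (rule q_of_ge_7[OF n])
  have e2: "4 / (q_of n) ^ 4 * e\<^sup>2 \<noteq> 0" using e0 q7 by simp
  have nonzero: "leaf_poly n e j \<noteq> 0" if j: "j \<in> {3..<n}" for j
  proof
    assume z: "leaf_poly n e j = 0"
    have j': "3 \<le> j" "j < n" using j by auto
    note loc = leaf_poly_zero_location[OF n j'(2) z]
    have rj: "shift n e j \<noteq> 0"
      using z coupling_bounds[OF n j'(2)] unfolding leaf_poly_def by auto
    have r0: "shift n e 0 \<noteq> 0"
    proof
      assume "shift n e 0 = 0"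
      then have "\<bar>e + 2 * diag_entry n 0\<bar> \<le> 1 / 2 \<or> \<bar>e + (diag_entry n 0)\<^sup>2\<bar> \<le> 1 / 2"
        by (simp add: shift_def)
      from locations_apart[OF n _ j'(2) _ this loc] j' show False by auto
    qed
    have others: "leaf_poly n e l \<noteq> 0" if "3 \<le> l" "l < n" "l \<noteq> j" for l
      using leaf_poly_zero_location[OF n that(2)] locations_apart[OF n that(2) j'(2) that(3)] loc by blast
    define D where "D s = degenerate_core_det s (eff n e 0) (shift n e 0) (diag_entry n 0)
        (eff n e 1) (shift n e 1) (diag_entry n 1) (eff n e 2) (shift n e 2) (diag_entry n 2) (diag_entry n j)
        (\<Sum>l\<in>{3..<n} - {j}. shift n e l / leaf_poly n e l)
        (\<Sum>l\<in>{3..<n} - {j}. shift n e l * diag_entry n l / leaf_poly n e l)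
        (\<Sum>l\<in>{3..<n} - {j}. shift n e l * (diag_entry n l)\<^sup>2 / leaf_poly n e l) (real n - 3)" for s
    have "D 1 = 0" unfolding D_def by (rule degenerate_core_det_zero[OF n _ p j' z rj]) (simp, erule (2) others)
    moreover have "D (-1) = 0" unfolding D_def by (rule degenerate_core_det_zero[OF n _ q j' z rj]) (simp, erule (2) others)
    moreover have "D 1 - D (-1) = - 4 * shift n e 0 * pencil_det n e (- (diag_entry n j)\<^sup>2) (diag_entry n j) 1"
      unfolding D_def by (rule degenerate_core_det_odd_part)
    ultimately have "- 4 * shift n e 0 * pencil_det n e (- (diag_entry n j)\<^sup>2) (diag_entry n j) 1 = 0" by linarith
    then have "pencil_det n e (- (diag_entry n j)\<^sup>2) (diag_entry n j) 1 = 0" using r0 by simp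
    then have "pencil_det n e (shift n e j * (- (diag_entry n j)\<^sup>2)) (shift n e j * diag_entry n j) (shift n e j * 1) = 0"
      unfolding pencil_det_linear by simp
    moreover have "shift n e j * (- (diag_entry n j)\<^sup>2) = eff n e j"
      using z unfolding leaf_poly_eff by simp
    ultimately have "pencil_det n e (eff n e j) (shift n e j * diag_entry n j) (shift n e j) = 0" by simp
    then show False unfolding pencil_det_vertex using e2 j' by auto
  qed
  define J where "J = {3..<n}"
  let ?p = "leaf_poly n e" and ?r = "shift n e" and ?d = "diag_entry n" and ?A = "eff n e"
  define \<sigma>0 where "\<sigma>0 = (\<Sum>j\<in>J. ?r j / ?p j)"
  define \<sigma>1 where "\<sigma>1 = (\<Sum>j\<in>J. ?r j * ?d j / ?p j)"
  define \<sigma>2 where "\<sigma>2 = (\<Sum>j\<in>J. ?r j * (?d j)\<^sup>2 / ?p j)"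
  have nz: "?p j \<noteq> 0" if "3 \<le> j" "j < n" for j using nonzero that by auto
  have "- 4 * pencil_det n e (?A 0 + ?r 0 * (real n - 3 - \<sigma>2)) (?r 0 * (?d 0 + \<sigma>1)) (?r 0 * (1 + \<sigma>0)) = 0"
    unfolding core_det_odd_part[symmetric] \<sigma>0_def \<sigma>1_def \<sigma>2_def J_def
    using core_det_zero[OF n _ p(1) p(2,3) nz] core_det_zero[OF n _ q(1) q(2,3) nz] by simp
  then have "pencil_det n e (?A 0 + ?r 0 * (real n - 3 - \<sigma>2)) (?r 0 * ?d 0 + ?r 0 * \<sigma>1) (?r 0 + ?r 0 * \<sigma>0) = 0"
    by (simp add: algebra_simps)
  then have D: "pencil_det n e (?A 0) (?r 0 * ?d 0) (?r 0)
      + ?r 0 * pencil_det n e (real n - 3 - \<sigma>2) \<sigma>1 \<sigma>0 = 0"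
    unfolding pencil_det_linear .
  \<comment> \<open>The three arguments are now written as sums of the triples of the leaves, with weights 1 / leaf_poly.\<close>
  have "real n - 3 - \<sigma>2 = (\<Sum>j\<in>J. 1 - ?r j * (?d j)\<^sup>2 / ?p j)"
    unfolding \<sigma>2_def J_def using n by (simp add: sum_subtractf of_nat_diff)
  also have "\<dots> = (\<Sum>j\<in>J. inverse (?p j) * ?A j)"
  proof (intro sum.cong refl)
    fix j assume "j \<in> J"
    then have "?p j \<noteq> 0" using nonzero J_def by simp
    moreover have "?A j = ?p j - ?r j * (?d j)\<^sup>2" by (simp add: leaf_poly_eff)
    ultimately show "1 - ?r j * (?d j)\<^sup>2 / ?p j = inverse (?p j) * ?A j" by (simp add: field_simps)
  qed
  finally have s2: "real n - 3 - \<sigma>2 = (\<Sum>j\<in>J. inverse (?p j) * ?A j)" .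
  have s1: "\<sigma>1 = (\<Sum>j\<in>J. inverse (?p j) * (?r j * ?d j))" and s0: "\<sigma>0 = (\<Sum>j\<in>J. inverse (?p j) * ?r j)"
    unfolding \<sigma>1_def \<sigma>0_def by (simp_all add: field_simps)
  have "pencil_det n e (real n - 3 - \<sigma>2) \<sigma>1 \<sigma>0 = (\<Sum>j\<in>J. inverse (?p j) * (4 / (q_of n) ^ 4 * e\<^sup>2 * ((real j - 1) * (real j - 2))))"
    unfolding s2 s1 s0 pencil_det_sum pencil_det_linear pencil_det_vertex ..
  also have "\<dots> = 4 / (q_of n) ^ 4 * e\<^sup>2 * (\<Sum>j\<in>J. (real j - 1) * (real j - 2) / ?p j)"
    unfolding sum_distrib_left by (intro sum.cong refl) (simp add: divide_inverse)
  finally have "4 / (q_of n) ^ 4 * e\<^sup>2 * (2 + ?r 0 * (\<Sum>j\<in>J. (real j - 1) * (real j - 2) / ?p j)) = 0"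
    using D unfolding pencil_det_vertex by (simp add: distrib_left mult.left_commute)
  then have "2 + ?r 0 * (\<Sum>j\<in>J. (real j - 1) * (real j - 2) / ?p j) = 0" using e2 by (simp only: mult_eq_0_iff) simp
  with nonzero show ?thesis unfolding J_def by blast
qed

definition leaf_polynomial :: "nat \<Rightarrow> nat \<Rightarrow> real poly" where
  "leaf_polynomial n j = [:2 * diag_entry n j, 1:] * [:(diag_entry n j)\<^sup>2, 1:] - [:(coupling n j)\<^sup>2:]"

lemma poly_leaf_polynomial: "poly (leaf_polynomial n j) e = leaf_poly n e j"
  by (simp add: leaf_polynomial_def leaf_poly_def shift_def algebra_simps)

lemma leaf_polynomial_monic: "degree (leaf_polynomial n j) = 2" "lead_coeff (leaf_polynomial n j) = 1"
  by (simp_all add: leaf_polynomial_def)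

text \<open>The equation for common eigenvalues, multiplied by the product of all leaf polynomials.\<close>

definition common_polynomial :: "nat \<Rightarrow> real poly" where
  "common_polynomial n = Polynomial.smult 2 (\<Prod>j\<in>{3..<n}. leaf_polynomial n j)
     + [:2 * diag_entry n 0, 1:] * (\<Sum>j\<in>{3..<n}. Polynomial.smult ((real j - 1) * (real j - 2)) (\<Prod>l\<in>{3..<n} - {j}. leaf_polynomial n l))"

text \<open>The second summand has degree at most \<open>2 n - 7\<close>, so that it cannot cancel the leading term.\<close>

lemma common_polynomial_degree:
  assumes "n \<ge> 4"
  shows "common_polynomial n \<noteq> 0" "degree (common_polynomial n) \<le> 2 * n - 6"
proof -
  define A where "A = Polynomial.smult 2 (\<Prod>j\<in>{3..<n}. leaf_polynomial n j)"
  define B where "B = [:2 * diag_entry n 0, 1:] * (\<Sum>j\<in>{3..<n}. Polynomial.smult ((real j - 1) * (real j - 2)) (\<Prod>l\<in>{3..<n} - {j}. leaf_polynomial n l))"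
  have prodd: "degree (\<Prod>l\<in>S. leaf_polynomial n l) = 2 * card S" for S
  proof (subst degree_prod_eq_sum_degree)
    show "\<forall>l\<in>S. leaf_polynomial n l \<noteq> 0"
      using leaf_polynomial_monic(1) by (metis degree_0 zero_neq_numeral)
  qed (simp add: leaf_polynomial_monic(1))
  have dA: "degree A = 2 * n - 6" unfolding A_def by (simp add: prodd)
  have "degree (\<Sum>j\<in>{3..<n}. Polynomial.smult ((real j - 1) * (real j - 2)) (\<Prod>l\<in>{3..<n} - {j}. leaf_polynomial n l)) \<le> 2 * (n - 4)"
  proof (rule degree_sum_le)
    fix j assume "j \<in> {3..<n}"
    then have "card ({3..<n} - {j}) = n - 4" by simp
    then show "degree (Polynomial.smult ((real j - 1) * (real j - 2)) (\<Prod>l\<in>{3..<n} - {j}. leaf_polynomial n l)) \<le> 2 * (n - 4)"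
      using prodd degree_smult_le[of "(real j - 1) * (real j - 2)" "\<Prod>l\<in>{3..<n} - {j}. leaf_polynomial n l"] by simp
  qed simp
  then have "degree B \<le> degree [:2 * diag_entry n 0, 1:] + 2 * (n - 4)"
    unfolding B_def by (intro order_trans[OF degree_mult_le] add_left_mono)
  then have "degree B < degree A" using dA assms by simp
  then have "degree (A + B) = degree A" by (simp add: degree_add_eq_left)
  moreover have "common_polynomial n = A + B" unfolding common_polynomial_def A_def B_def ..
  ultimately show "degree (common_polynomial n) \<le> 2 * n - 6" "common_polynomial n \<noteq> 0" using dA assms by auto
qed

lemma card_common_eigenvalues:
  assumes n: "n \<ge> 4"
    and E: "\<And>e. e \<in> E \<Longrightarrow> \<exists>u v k. half_eigenvector n 1 e u v \<and> k < n \<and> (u k \<noteq> 0 \<or> v k \<noteq> 0)"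
      "\<And>e. e \<in> E \<Longrightarrow> \<exists>u v k. half_eigenvector n (-1) e u v \<and> k < n \<and> (u k \<noteq> 0 \<or> v k \<noteq> 0)"
  shows "card E \<le> 2 * n - 6"
proof -
  have "E \<subseteq> {e. poly (common_polynomial n) e = 0}"
  proof clarify
    fix e assume "e \<in> E"
    with E obtain u v k u' v' k' where
      h: "half_eigenvector n 1 e u v" "k < n" "u k \<noteq> 0 \<or> v k \<noteq> 0"
        "half_eigenvector n (-1) e u' v'" "k' < n" "u' k' \<noteq> 0 \<or> v' k' \<noteq> 0" by meson
    let ?p = "leaf_poly n e"
    from common_eigenvalue_equation[OF n h] have nz: "\<And>j. j \<in> {3..<n} \<Longrightarrow> ?p j \<noteq> 0"
      and eq: "2 + shift n e 0 * (\<Sum>j\<in>{3..<n}. (real j - 1) * (real j - 2) / ?p j) = 0" by auto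
    have rem: "(\<Prod>l\<in>{3..<n} - {j}. ?p l) = (\<Prod>l\<in>{3..<n}. ?p l) / ?p j" if "j \<in> {3..<n}" for j
      using nz[OF that] that by (simp add: prod.remove)
    have "poly (common_polynomial n) e = 2 * (\<Prod>j\<in>{3..<n}. ?p j)
        + shift n e 0 * (\<Sum>j\<in>{3..<n}. (real j - 1) * (real j - 2) * (\<Prod>l\<in>{3..<n} - {j}. ?p l))"
      unfolding common_polynomial_def
      by (simp add: poly_prod poly_sum poly_leaf_polynomial shift_def distrib_right add.commute)
    also have "(\<Sum>j\<in>{3..<n}. (real j - 1) * (real j - 2) * (\<Prod>l\<in>{3..<n} - {j}. ?p l))
        = (\<Prod>l\<in>{3..<n}. ?p l) * (\<Sum>j\<in>{3..<n}. (real j - 1) * (real j - 2) / ?p j)"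
      unfolding sum_distrib_left by (intro sum.cong refl) (simp add: rem)
    also have "2 * (\<Prod>j\<in>{3..<n}. ?p j) + shift n e 0 * ((\<Prod>l\<in>{3..<n}. ?p l) * (\<Sum>j\<in>{3..<n}. (real j - 1) * (real j - 2) / ?p j))
        = (\<Prod>j\<in>{3..<n}. ?p j) * (2 + shift n e 0 * (\<Sum>j\<in>{3..<n}. (real j - 1) * (real j - 2) / ?p j))"
      by (simp add: algebra_simps)
    also have "\<dots> = 0" unfolding eq by simp
    finally show "poly (common_polynomial n) e = 0" .
  qed
  then have "card E \<le> card {e. poly (common_polynomial n) e = 0}"
    using common_polynomial_degree[OF n] by (intro card_mono poly_roots_finite)
  also have "\<dots> \<le> degree (common_polynomial n)"
    using common_polynomial_degree[OF n] by (intro card_poly_roots_bound)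
  finally show ?thesis using common_polynomial_degree[OF n] by simp
qed

section \<open>Decoupling of the first-order matrix at parameter 0\<close>

lemma small_mat_entries:
  "alpha_mat \<in> carrier_mat 2 2" "beta_mat \<in> carrier_mat 2 2" "U_mat \<in> carrier_mat 2 2"
  "alpha_mat $$ (0,0) = 1" "alpha_mat $$ (0,Suc 0) = 0" "alpha_mat $$ (Suc 0,0) = 0" "alpha_mat $$ (Suc 0,Suc 0) = -1"
  "beta_mat $$ (0,0) = 0" "beta_mat $$ (0,Suc 0) = 1" "beta_mat $$ (Suc 0,0) = 1" "beta_mat $$ (Suc 0,Suc 0) = 0"
  "U_mat $$ (0,0) = 0" "U_mat $$ (0,Suc 0) = -1" "U_mat $$ (Suc 0,0) = 1" "U_mat $$ (Suc 0,Suc 0) = 0"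
  by (auto simp: alpha_mat_def beta_mat_def U_mat_def mat_of_rows_list_def)

lemma small_mat_dims [simp]:
  "dim_row alpha_mat = 2" "dim_col alpha_mat = 2" "dim_row beta_mat = 2" "dim_col beta_mat = 2"
  "dim_row U_mat = 2" "dim_col U_mat = 2"
  using small_mat_entries(1-3) by auto

lemma sum_pairs:
  fixes f :: "nat \<Rightarrow> real"
  shows "(\<Sum>i<2 * n. f i) = (\<Sum>k<n. f (2 * k) + f (2 * k + 1))"
  by (induction n) (simp_all add: algebra_simps)

lemma A_mat_carrier: "A_mat n b \<in> carrier_mat (2 * n) (2 * n)"
  by (simp add: A_mat_def)

lemma B_mat_carrier: "B_mat n \<in> carrier_mat (2 * n) (2 * n)"
  by (simp add: B_mat_def kronecker_prod_def mult.commute)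

definition A_entry :: "nat \<Rightarrow> real \<Rightarrow> nat \<Rightarrow> nat \<Rightarrow> nat \<Rightarrow> nat \<Rightarrow> real" where
  "A_entry n b k l s t = A_block n b (k + 1) (l + 1) $$ (s, t)"

lemma A_mat_entry:
  assumes "k < n" "l < n" "s < 2" "t < 2"
  shows "A_mat n b $$ (2 * k + s, 2 * l + t) = A_entry n b k l s t"
proof -
  have "2 * k + s < 2 * n" "2 * l + t < 2 * n" using assms by linarith+
  then show ?thesis using assms unfolding A_mat_def A_entry_def by simp
qed

lemma B_mat_entry:
  assumes "k < n" "l < n" "s < 2" "t < 2"
  shows "B_mat n $$ (2 * k + s, 2 * l + t) = (if k = l then U_mat $$ (s, t) else 0)"
proof -
  have "2 * k + s < n * 2" "2 * l + t < n * 2" using assms by linarith+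
  then show ?thesis using assms unfolding B_mat_def kronecker_prod_def by simp
qed

lemma A_entry_eq:
  assumes "s < 2" "t < 2"
  shows "A_entry n b k l s t =
    (if k = l then diag_entry n k * U_mat $$ (s, t)
     else if k = 0 then alpha_mat $$ (s, t) else if l = 0 then - alpha_mat $$ (s, t)
     else if k = 1 \<and> l = 2 then b * alpha_mat $$ (s, t) + beta_mat $$ (s, t)
     else if k = 2 \<and> l = 1 then - (b * alpha_mat $$ (s, t)) - beta_mat $$ (s, t)
     else if k = 1 \<and> l = 3 then b * alpha_mat $$ (s, t)
     else if k = 3 \<and> l = 1 then - (b * alpha_mat $$ (s, t)) else 0)"
  using assms unfolding A_entry_def A_block_def diag_entry_def by auto

text \<open>\<open>U\<close> anticommutes with \<open>\<alpha>\<close> and \<open>\<beta>\<close> and squares to \<open>-1\<close>, so only the diagonal blocks survive in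
  the anticommutator of \<open>A\<close> and \<open>B\<close>.\<close>

lemma A_entry_anticommute:
  assumes "s < 2" "t < 2"
  shows "(\<Sum>r<2. A_entry n b k l s r * U_mat $$ (r, t)) + (\<Sum>r<2. U_mat $$ (s, r) * A_entry n b k l r t)
    = (if k = l \<and> s = t then - 2 * diag_entry n k else 0)"
proof -
  have "{..<2::nat} = {0, Suc 0}" by auto
  moreover have "s = 0 \<or> s = Suc 0" "t = 0 \<or> t = Suc 0" using assms by auto
  ultimately show ?thesis
    by (elim disjE) (simp_all add: A_entry_eq small_mat_entries)
qed

lemma mat_mult_entry:
  fixes A B :: "real mat"
  assumes "A \<in> carrier_mat m m" "B \<in> carrier_mat m m" "i < m" "j < m"
  shows "(A * B) $$ (i, j) = (\<Sum>k<m. A $$ (i, k) * B $$ (k, j))"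
  using assms by (auto simp: scalar_prod_def lessThan_atLeast0 intro!: sum.cong)

lemma sum_less_2: "(\<Sum>r<2. f r) = f 0 + f (Suc 0)" for f :: "nat \<Rightarrow> real"
  by (simp add: numeral_2_eq_2)

lemma K_mat_eq:
  "K_mat n b = mat (2 * n) (2 * n) (\<lambda>(i, j). if i = j then - 2 * diag_entry n (i div 2) else 0)"
proof (rule eq_matI)
  show "dim_row (K_mat n b) = dim_row (mat (2 * n) (2 * n) (\<lambda>(i, j). if i = j then - 2 * diag_entry n (i div 2) else 0))"
    "dim_col (K_mat n b) = dim_col (mat (2 * n) (2 * n) (\<lambda>(i, j). if i = j then - 2 * diag_entry n (i div 2) else 0))"
    using A_mat_carrier[of n b] B_mat_carrier[of n] by (auto simp: K_mat_def)
  fix i j assume "i < dim_row (mat (2 * n) (2 * n) (\<lambda>(i, j). if i = j then - 2 * diag_entry n (i div 2) else 0))"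
    "j < dim_col (mat (2 * n) (2 * n) (\<lambda>(i, j). if i = j then - 2 * diag_entry n (i div 2) else 0))"
  then have ij: "i < 2 * n" "j < 2 * n" by auto
  define k s l t where "k = i div 2" "s = i mod 2" "l = j div 2" "t = j mod 2"
  have i: "i = 2 * k + s" and j: "j = 2 * l + t" and st: "s < 2" "t < 2" and kl: "k < n" "l < n"
    unfolding k_s_l_t_def using ij by auto
  have "(A_mat n b * B_mat n) $$ (i, j) = (\<Sum>m<n. \<Sum>r<2. A_mat n b $$ (i, 2 * m + r) * B_mat n $$ (2 * m + r, j))"
    by (simp add: mat_mult_entry[OF A_mat_carrier B_mat_carrier ij] sum_pairs sum_less_2)
  also have "\<dots> = (\<Sum>m<n. if m = l then \<Sum>r<2. A_entry n b k m s r * U_mat $$ (r, t) else 0)"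
    unfolding i j using kl st by (intro sum.cong refl) (simp add: A_mat_entry B_mat_entry del: mult_2)
  also have "\<dots> = (\<Sum>r<2. A_entry n b k l s r * U_mat $$ (r, t))" using kl by simp
  finally have AB: "(A_mat n b * B_mat n) $$ (i, j) = \<dots>" .
  have "(B_mat n * A_mat n b) $$ (i, j) = (\<Sum>m<n. \<Sum>r<2. B_mat n $$ (i, 2 * m + r) * A_mat n b $$ (2 * m + r, j))"
    by (simp add: mat_mult_entry[OF B_mat_carrier A_mat_carrier ij] sum_pairs sum_less_2)
  also have "\<dots> = (\<Sum>m<n. if m = k then \<Sum>r<2. U_mat $$ (s, r) * A_entry n b m l r t else 0)"
    unfolding i j using kl st by (intro sum.cong refl) (simp add: A_mat_entry B_mat_entry)
  also have "\<dots> = (\<Sum>r<2. U_mat $$ (s, r) * A_entry n b k l r t)" using kl by simp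
  finally have BA: "(B_mat n * A_mat n b) $$ (i, j) = \<dots>" .
  have "K_mat n b $$ (i, j) = (A_mat n b * B_mat n) $$ (i, j) + (B_mat n * A_mat n b) $$ (i, j)"
    unfolding K_mat_def using ij A_mat_carrier[of n b] B_mat_carrier[of n] by auto
  also have "\<dots> = (if k = l \<and> s = t then - 2 * diag_entry n k else 0)"
    unfolding AB BA by (rule A_entry_anticommute[OF st])
  also have "k = l \<and> s = t \<longleftrightarrow> i = j" unfolding i j using st by presburger
  finally show "K_mat n b $$ (i, j) = mat (2 * n) (2 * n) (\<lambda>(i, j). if i = j then - 2 * diag_entry n (i div 2) else 0) $$ (i, j)"
    using ij by (simp add: k_s_l_t_def)
qed

text \<open>The real part after the substitution \<open>z\<^sub>j \<mapsto> \<i> z\<^sub>j\<close> for \<open>j > 0\<close>; \<open>q_half\<close> is the imaginary part.\<close>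

definition p_half :: "(nat \<Rightarrow> real) \<Rightarrow> nat \<Rightarrow> real" where
  "p_half x k = (if k = 0 then x 0 else x (2 * k + 1))"

definition q_half :: "(nat \<Rightarrow> real) \<Rightarrow> nat \<Rightarrow> real" where
  "q_half x k = (if k = 0 then x 1 else - x (2 * k))"

lemma arrow_cong:
  assumes "n \<ge> 4" "\<And>i. i < n \<Longrightarrow> u i = u' i" "k < n"
  shows "arrow n s u k = arrow n s u' k"
  using assms by (auto simp: arrow_def)

lemma arrow_uminus: "arrow n s (\<lambda>i. - u i) k = - arrow n s u k"
  by (simp add: arrow_def sum_negf algebra_simps)

lemma A_mat_mult_vec:
  assumes x: "x \<in> carrier_vec (2 * n)" and k: "k < n" and s: "s < 2"
  shows "vec_index (A_mat n b *\<^sub>v x) (2 * k + s)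
    = (\<Sum>l<n. A_entry n b k l s 0 * vec_index x (2 * l) + A_entry n b k l s 1 * vec_index x (2 * l + 1))"
proof -
  have i: "2 * k + s < 2 * n" using k s by linarith
  have "vec_index (A_mat n b *\<^sub>v x) (2 * k + s) = (\<Sum>j<2 * n. A_mat n b $$ (2 * k + s, j) * vec_index x j)"
    by (rule mult_mat_vec_sum[OF A_mat_carrier x i])
  also have "\<dots> = (\<Sum>l<n. A_entry n b k l s 0 * vec_index x (2 * l) + A_entry n b k l s 1 * vec_index x (2 * l + 1))"
    unfolding sum_pairs using k s A_mat_entry[of k n _ s 0 b] A_mat_entry[of k n _ s 1 b]
    by (intro sum.cong refl) simp
  finally show ?thesis .
qed

text \<open>In the new coordinates \<open>A\<close> maps \<open>p + \<i> q\<close> to \<open>- (D + S) q + \<i> (D - S) p\<close>. Hence its square preserves the two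
  parts, with \<open>-(D + S)(D - S)\<close> on the real and \<open>-(D - S)(D + S)\<close> on the imaginary one.\<close>

lemma A_mat_swaps_halves:
  assumes n: "n \<ge> 4" and x: "x \<in> carrier_vec (2 * n)" and k: "k < n"
  shows "p_half (vec_index (A_mat n 0 *\<^sub>v x)) k = - arrow n 1 (q_half (vec_index x)) k"
    and "q_half (vec_index (A_mat n 0 *\<^sub>v x)) k = arrow n (-1) (p_half (vec_index x)) k"
proof -
  let ?y = "vec_index (A_mat n 0 *\<^sub>v x)" and ?x = "vec_index x"
  have even: "?y (2 * k) = (\<Sum>l<n. A_entry n 0 k l 0 0 * ?x (2 * l) + A_entry n 0 k l 0 1 * ?x (2 * l + 1))"
    and odd: "?y (2 * k + 1) = (\<Sum>l<n. A_entry n 0 k l 1 0 * ?x (2 * l) + A_entry n 0 k l 1 1 * ?x (2 * l + 1))"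
    using A_mat_mult_vec[OF x k, of 0 0] A_mat_mult_vec[OF x k, of 1 0] by simp_all
  note ent = small_mat_entries
  have first: "(\<Sum>l<n. f l) = f 0 + (\<Sum>l\<in>{1..<n}. f l)" for f :: "nat \<Rightarrow> real"
    using n by (simp add: lessThan_atLeast0 sum.atLeast_Suc_lessThan)
  show "p_half ?y k = - arrow n 1 (q_half ?x) k"
  proof (cases "k = 0")
    case True
    have "?y 0 = - (diag_entry n 0 * ?x 1) + (\<Sum>l\<in>{1..<n}. ?x (2 * l))"
      using even True unfolding first by (simp add: A_entry_eq ent)
    moreover have "(\<Sum>l\<in>{1..<n}. q_half ?x l) = - (\<Sum>l\<in>{1..<n}. ?x (2 * l))"
      unfolding sum_negf[symmetric] by (intro sum.cong) (auto simp: q_half_def)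
    ultimately show ?thesis using True by (simp add: p_half_def arrow_def q_half_def)
  next
    case False
    have "?y (2 * k + 1) = (\<Sum>l<n. (if l = k then diag_entry n k * ?x (2 * l) else 0) + (if l = 0 then ?x 1 else 0)
       + (if l = 2 then if k = 1 then ?x 4 else 0 else 0) + (if l = 1 then if k = 2 then - ?x 2 else 0 else 0))"
      unfolding odd using False by (intro sum.cong refl) (auto simp: A_entry_eq ent)
    also have "\<dots> = diag_entry n k * ?x (2 * k) + ?x 1 + (if k = 1 then ?x 4 else 0) + (if k = 2 then - ?x 2 else 0)"
      unfolding sum.distrib using n k by simp
    finally show ?thesis using False by (simp add: p_half_def arrow_def q_half_def)
  qed
  show "q_half ?y k = arrow n (-1) (p_half ?x) k"
  proof (cases "k = 0")
    case True
    have "?y 1 = diag_entry n 0 * ?x 0 - (\<Sum>l\<in>{1..<n}. ?x (2 * l + 1))"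
      using odd True unfolding first sum_negf[symmetric] by (simp add: A_entry_eq ent sum_negf)
    moreover have "(\<Sum>l\<in>{1..<n}. p_half ?x l) = (\<Sum>l\<in>{1..<n}. ?x (2 * l + 1))"
      by (intro sum.cong) (auto simp: p_half_def)
    ultimately show ?thesis using True by (simp add: p_half_def arrow_def q_half_def)
  next
    case False
    have "?y (2 * k) = (\<Sum>l<n. (if l = k then - diag_entry n k * ?x (2 * l + 1) else 0) + (if l = 0 then - ?x 0 else 0)
       + (if l = 2 then if k = 1 then ?x 5 else 0 else 0) + (if l = 1 then if k = 2 then - ?x 3 else 0 else 0))"
      unfolding even using False by (intro sum.cong refl) (auto simp: A_entry_eq ent)
    also have "\<dots> = - diag_entry n k * ?x (2 * k + 1) - ?x 0 + (if k = 1 then ?x 5 else 0) + (if k = 2 then - ?x 3 else 0)"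
      unfolding sum.distrib using n k by simp
    finally show ?thesis using False by (simp add: p_half_def arrow_def q_half_def)
  qed
qed

section \<open>The pencil\<close>

definition pencil_mat :: "nat \<Rightarrow> real \<Rightarrow> real mat" where
  "pencil_mat n b = X_mat \<otimes>\<^sub>K H_mat n b + Y_mat n \<otimes>\<^sub>K K_mat n b"

lemma XY_entries:
  "dim_row X_mat = 2" "dim_col X_mat = 2" "dim_row (Y_mat n) = 2" "dim_col (Y_mat n) = 2"
  "X_mat $$ (0,0) = 1" "X_mat $$ (0,Suc 0) = 0" "X_mat $$ (Suc 0,0) = 0" "X_mat $$ (Suc 0,Suc 0) = 0"
  "Y_mat n $$ (0,0) = 0" "Y_mat n $$ (0,Suc 0) = 1 / (q_of n)\<^sup>2" "Y_mat n $$ (Suc 0,0) = 1 / (q_of n)\<^sup>2"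
  "Y_mat n $$ (Suc 0,Suc 0) = 1"
  by (auto simp: X_mat_def Y_mat_def mat_of_rows_list_def)

lemma H_mat_carrier: "H_mat n b \<in> carrier_mat (2 * n) (2 * n)"
  using A_mat_carrier[of n b] by (auto simp: H_mat_def)

lemma K_mat_carrier: "K_mat n b \<in> carrier_mat (2 * n) (2 * n)"
  by (simp add: K_mat_eq)

lemma pencil_mat_carrier: "pencil_mat n b \<in> carrier_mat (4 * n) (4 * n)"
  using H_mat_carrier[of n b] K_mat_carrier[of n b]
  by (auto simp: pencil_mat_def kronecker_prod_def XY_entries)

lemma pencil_mat_entry:
  assumes "i < 4 * n" "j < 4 * n"
  shows "pencil_mat n b $$ (i, j) =
     X_mat $$ (i div (2 * n), j div (2 * n)) * H_mat n b $$ (i mod (2 * n), j mod (2 * n))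
     + Y_mat n $$ (i div (2 * n), j div (2 * n)) * K_mat n b $$ (i mod (2 * n), j mod (2 * n))"
  using assms H_mat_carrier[of n b] K_mat_carrier[of n b]
  by (auto simp: pencil_mat_def kronecker_prod_def XY_entries)

lemma A_mat_antisymmetric:
  assumes "i < 2 * n" "j < 2 * n"
  shows "A_mat n b $$ (j, i) = - A_mat n b $$ (i, j)"
proof -
  define k s l t where "k = i div 2" "s = i mod 2" "l = j div 2" "t = j mod 2"
  have i: "i = 2 * k + s" and j: "j = 2 * l + t" and st: "s < 2" "t < 2" and kl: "k < n" "l < n"
    unfolding k_s_l_t_def using assms by auto
  have "s = 0 \<or> s = Suc 0" "t = 0 \<or> t = Suc 0" using st by auto
  then have "A_entry n b l k t s = - A_entry n b k l s t"
    by (elim disjE) (auto simp: A_entry_eq small_mat_entries)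
  then show ?thesis unfolding i j using kl st by (simp add: A_mat_entry)
qed

lemma H_mat_symmetric:
  assumes "i < 2 * n" "j < 2 * n"
  shows "H_mat n b $$ (j, i) = H_mat n b $$ (i, j)"
  unfolding H_mat_def mat_mult_entry[OF A_mat_carrier A_mat_carrier assms]
    mat_mult_entry[OF A_mat_carrier A_mat_carrier assms(2,1)]
proof (intro sum.cong refl)
  fix k assume "k \<in> {..<2 * n}"
  then have k: "k < 2 * n" by simp
  show "A_mat n b $$ (j, k) * A_mat n b $$ (k, i) = A_mat n b $$ (i, k) * A_mat n b $$ (k, j)"
    using A_mat_antisymmetric[OF k assms(2), of b] A_mat_antisymmetric[OF assms(1) k, of b]  by simp
qed

lemma pencil_mat_symmetric:
  assumes "n > 0"
  shows "(pencil_mat n b)\<^sup>T = pencil_mat n b"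
proof (rule eq_matI)
  fix i j assume "i < dim_row (pencil_mat n b)" "j < dim_col (pencil_mat n b)"
  then have ij: "i < 4 * n" "j < 4 * n" using pencil_mat_carrier[of n b] by auto
  have "i div (2 * n) < 2" "j div (2 * n) < 2" using ij assms by (auto simp: less_mult_imp_div_less)
  then have d: "i div (2 * n) = 0 \<or> i div (2 * n) = Suc 0" "j div (2 * n) = 0 \<or> j div (2 * n) = Suc 0" by auto
  have m: "i mod (2 * n) < 2 * n" "j mod (2 * n) < 2 * n" using assms by auto
  have K: "K_mat n b $$ (j mod (2 * n), i mod (2 * n)) = K_mat n b $$ (i mod (2 * n), j mod (2 * n))"
    using m by (auto simp: K_mat_eq)
  have "pencil_mat n b $$ (j, i) = pencil_mat n b $$ (i, j)"
    unfolding pencil_mat_entry[OF ij] pencil_mat_entry[OF ij(2,1)] H_mat_symmetric[OF m] K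
    using d by (elim disjE) (simp_all only: XY_entries)
  then show "(pencil_mat n b)\<^sup>T $$ (i, j) = pencil_mat n b $$ (i, j)"
    using ij pencil_mat_carrier[of n b] by auto
qed (use pencil_mat_carrier[of n b] in auto)

lemma sum_lessThan_add:
  fixes f :: "nat \<Rightarrow> real"
  shows "(\<Sum>i<m + k. f i) = (\<Sum>i<m. f i) + (\<Sum>i<k. f (m + i))"
  by (induction k) (simp_all add: algebra_simps)

lemma pencil_mat_mult_vec:
  assumes n: "n > 0" and z: "z \<in> carrier_vec (4 * n)" and i: "i < 2 * n"
  defines "x \<equiv> vec (2 * n) (vec_index z)" and "y \<equiv> \<lambda>j. vec_index z (2 * n + j)"
  shows "vec_index (pencil_mat n b *\<^sub>v z) i = vec_index (H_mat n b *\<^sub>v x) i - coupling n (i div 2) * y i"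
    "vec_index (pencil_mat n b *\<^sub>v z) (2 * n + i)
      = - (coupling n (i div 2) * vec_index z i) - 2 * diag_entry n (i div 2) * y i"
proof -
  have x: "x \<in> carrier_vec (2 * n)" by (simp add: x_def)
  have mv: "vec_index (pencil_mat n b *\<^sub>v z) a = (\<Sum>j<2 * n. pencil_mat n b $$ (a, j) * vec_index z j)
      + (\<Sum>j<2 * n. pencil_mat n b $$ (a, 2 * n + j) * vec_index z (2 * n + j))" if "a < 4 * n" for a
    using mult_mat_vec_sum[OF pencil_mat_carrier z that] sum_lessThan_add[of _ "2 * n" "2 * n"] by simp
  have K: "K_mat n b $$ (i, j) = (if j = i then - 2 * diag_entry n (i div 2) else 0)" if "j < 2 * n" for j
    using i that by (simp add: K_mat_eq)
  have e00: "pencil_mat n b $$ (i, j) = H_mat n b $$ (i, j)"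
    and e01: "pencil_mat n b $$ (i, 2 * n + j) = (if j = i then - coupling n (i div 2) else 0)"
    and e10: "pencil_mat n b $$ (2 * n + i, j) = (if j = i then - coupling n (i div 2) else 0)"
    and e11: "pencil_mat n b $$ (2 * n + i, 2 * n + j) = (if j = i then - 2 * diag_entry n (i div 2) else 0)"
    if j: "j < 2 * n" for j
    using i j n K[OF j] by (simp_all add: pencil_mat_entry XY_entries coupling_def)
  have "(\<Sum>j<2 * n. H_mat n b $$ (i, j) * vec_index z j) = vec_index (H_mat n b *\<^sub>v x) i"
    unfolding mult_mat_vec_sum[OF H_mat_carrier x i] by (intro sum.cong) (auto simp: x_def)
  then show "vec_index (pencil_mat n b *\<^sub>v z) i = vec_index (H_mat n b *\<^sub>v x) i - coupling n (i div 2) * y i"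
    using i by (simp add: mv e00 e01 y_def if_distrib[of "\<lambda>c. c * _"] cong: if_cong)
  show "vec_index (pencil_mat n b *\<^sub>v z) (2 * n + i)
      = - (coupling n (i div 2) * vec_index z i) - 2 * diag_entry n (i div 2) * y i"
    using i by (simp add: mv e10 e11 y_def if_distrib[of "\<lambda>c. c * _"] cong: if_cong)
qed

lemma eigenvector_halves:
  assumes n: "n \<ge> 4" and z: "z \<in> carrier_vec (4 * n)" and ev: "pencil_mat n 0 *\<^sub>v z = e \<cdot>\<^sub>v z"
  shows "half_eigenvector n (-1) e (p_half (vec_index z)) (p_half (\<lambda>j. vec_index z (2 * n + j)))"
    and "half_eigenvector n 1 e (q_half (vec_index z)) (q_half (\<lambda>j. vec_index z (2 * n + j)))"
proof -
  define x where "x = vec (2 * n) (vec_index z)"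
  define y where "y = (\<lambda>j. vec_index z (2 * n + j))"
  define w where "w = vec_index (A_mat n 0 *\<^sub>v (A_mat n 0 *\<^sub>v x))"
  have x: "x \<in> carrier_vec (2 * n)" by (simp add: x_def)
  have Ax: "A_mat n 0 *\<^sub>v x \<in> carrier_vec (2 * n)" using A_mat_carrier[of n 0] x by auto
  have n0: "n > 0" using n by simp
  have H: "H_mat n 0 *\<^sub>v x = A_mat n 0 *\<^sub>v (A_mat n 0 *\<^sub>v x)"
    unfolding H_mat_def using A_mat_carrier[of n 0] x by (simp add: assoc_mult_mat_vec)
  have ez: "vec_index (pencil_mat n 0 *\<^sub>v z) a = e * vec_index z a" if "a < 4 * n" for a
    unfolding ev using z that by simp
  have top: "w i - coupling n (i div 2) * y i = e * vec_index z i"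
    and bot: "- (coupling n (i div 2) * vec_index z i) - 2 * diag_entry n (i div 2) * y i = e * y i" if "i < 2 * n" for i
    using pencil_mat_mult_vec[OF n0 z that, of 0, folded x_def] ez[of i] ez[of "2 * n + i"] that
    unfolding w_def H[symmetric] y_def by simp_all
  have px: "p_half (vec_index x) k = p_half (vec_index z) k"
    and qx: "q_half (vec_index x) k = q_half (vec_index z) k" if "k < n" for k
    using that n by (auto simp: p_half_def q_half_def x_def)
  have pw: "p_half w k = - arrow n 1 (arrow n (-1) (p_half (vec_index z))) k" if k: "k < n" for k
  proof -
    have "p_half w k = - arrow n 1 (q_half (vec_index (A_mat n 0 *\<^sub>v x))) k"
      unfolding w_def by (rule A_mat_swaps_halves(1)[OF n Ax k])
    also have "arrow n 1 (q_half (vec_index (A_mat n 0 *\<^sub>v x))) k = arrow n 1 (arrow n (-1) (p_half (vec_index z))) k"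
      using arrow_cong[OF n, of "p_half (vec_index x)" "p_half (vec_index z)" _ "-1"] px
      by (intro arrow_cong[OF n _ k]) (simp add: A_mat_swaps_halves(2)[OF n x])
    finally show ?thesis .
  qed
  have qw: "q_half w k = - arrow n (-1) (arrow n 1 (q_half (vec_index z))) k" if k: "k < n" for k
  proof -
    have "q_half w k = arrow n (-1) (p_half (vec_index (A_mat n 0 *\<^sub>v x))) k"
      unfolding w_def by (rule A_mat_swaps_halves(2)[OF n Ax k])
    also have "\<dots> = arrow n (-1) (\<lambda>i. - arrow n 1 (q_half (vec_index z)) i) k"
      using arrow_cong[OF n, of "q_half (vec_index x)" "q_half (vec_index z)" _ 1] qx
      by (intro arrow_cong[OF n _ k]) (simp add: A_mat_swaps_halves(1)[OF n x])
    finally show ?thesis by (simp add: arrow_uminus)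
  qed
  have idx: "(2 * k + 1) div 2 = k" "(2 * k) div 2 = k" "(1::nat) div 2 = 0" for k :: nat by simp_all
  show "half_eigenvector n (-1) e (p_half (vec_index z)) (p_half (\<lambda>j. vec_index z (2 * n + j)))"
    unfolding half_eigenvector_def y_def[symmetric]
  proof (intro allI impI)
    fix k assume k: "k < n"
    define i where "i = (if k = 0 then 0 else 2 * k + 1)"
    have i: "i < 2 * n" "i div 2 = k" using k unfolding i_def by auto
    have "p_half w k = w i" "p_half y k = y i" "p_half (vec_index z) k = vec_index z i"
      by (simp_all add: p_half_def i_def)
    with top[OF i(1)] bot[OF i(1)] pw[OF k]
    show "- arrow n (- (- 1)) (arrow n (- 1) (p_half (vec_index z))) k - coupling n k * p_half y k = e * p_half (vec_index z) k \<and>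
       - (coupling n k * p_half (vec_index z) k) - 2 * diag_entry n k * p_half y k = e * p_half y k"
      unfolding i(2) by simp
  qed
  show "half_eigenvector n 1 e (q_half (vec_index z)) (q_half (\<lambda>j. vec_index z (2 * n + j)))"
    unfolding half_eigenvector_def y_def[symmetric]
  proof (intro allI impI)
    fix k assume k: "k < n"
    define i where "i = (if k = 0 then 1 else 2 * k)"
    define g where "g = (if k = 0 then 1 else -1 :: real)"
    have i: "i < 2 * n" "i div 2 = k" using k unfolding i_def by auto
    have h: "q_half w k = g * w i" "q_half y k = g * y i" "q_half (vec_index z) k = g * vec_index z i"
      by (simp_all add: q_half_def i_def g_def)
    have "g * (w i - coupling n k * y i) = g * (e * vec_index z i)"
      "g * (- (coupling n k * vec_index z i) - 2 * diag_entry n k * y i) = g * (e * y i)"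
      using top[OF i(1)] bot[OF i(1)] unfolding i(2) by simp_all
    then show "- arrow n (- 1) (arrow n 1 (q_half (vec_index z))) k - coupling n k * q_half y k = e * q_half (vec_index z) k \<and>
       - (coupling n k * q_half (vec_index z) k) - 2 * diag_entry n k * q_half y k = e * q_half y k"
      unfolding qw[OF k, symmetric] h by (simp add: algebra_simps)
  qed
qed


lemma halves_determine_vector:
  assumes z: "z \<in> carrier_vec (4 * n)"
    and p: "\<And>k. k < n \<Longrightarrow> p_half (vec_index z) k = 0 \<and> p_half (\<lambda>j. vec_index z (2 * n + j)) k = 0"
    and q: "\<And>k. k < n \<Longrightarrow> q_half (vec_index z) k = 0 \<and> q_half (\<lambda>j. vec_index z (2 * n + j)) k = 0"
  shows "z = 0\<^sub>v (4 * n)"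
proof (rule eq_vecI)
  fix a assume "a < dim_vec (0\<^sub>v (4 * n) :: real vec)"
  then have a: "a < 4 * n" by simp
  have half: "x i = 0" if x: "\<And>k. k < n \<Longrightarrow> p_half x k = 0 \<and> q_half x k = 0" and i: "i < 2 * n" for x i
  proof -
    have k: "i div 2 < n" using i by auto
    have "i = 2 * (i div 2) \<or> i = 2 * (i div 2) + 1" by presburger
    then show ?thesis using x[OF k] by (cases "i div 2 = 0") (auto simp: p_half_def q_half_def)
  qed
  show "vec_index z a = vec_index (0\<^sub>v (4 * n)) a"
  proof (cases "a < 2 * n")
    case True
    then show ?thesis using half[of "vec_index z" a] p q a by simp
  next
    case False
    then have "vec_index z (2 * n + (a - 2 * n)) = 0"
      using a p q by (intro half) auto
    then show ?thesis using False a by simp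
  qed
qed (use z in simp)

definition lin_comb :: "nat \<Rightarrow> nat \<Rightarrow> (nat \<Rightarrow> real) \<Rightarrow> (nat \<Rightarrow> real vec) \<Rightarrow> real vec" where
  "lin_comb m k c x = vec m (\<lambda>a. \<Sum>i<k. c i * vec_index (x i) a)"

lemma lin_comb_eigenvector:
  fixes A :: "real mat"
  assumes A: "A \<in> carrier_mat m m" and x: "\<And>i. i < k \<Longrightarrow> x i \<in> carrier_vec m \<and> A *\<^sub>v x i = e \<cdot>\<^sub>v x i"
  shows "A *\<^sub>v lin_comb m k c x = e \<cdot>\<^sub>v lin_comb m k c x"
proof (rule eq_vecI)
  fix a assume "a < dim_vec (e \<cdot>\<^sub>v lin_comb m k c x)"
  then have a: "a < m" by (simp add: lin_comb_def)
  have "vec_index (A *\<^sub>v lin_comb m k c x) a = (\<Sum>j<m. A $$ (a, j) * (\<Sum>i<k. c i * vec_index (x i) j))"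
    by (subst mult_mat_vec_sum[OF A _ a]) (simp_all add: lin_comb_def)
  also have "\<dots> = (\<Sum>i<k. c i * (\<Sum>j<m. A $$ (a, j) * vec_index (x i) j))"
    unfolding sum_distrib_left by (subst sum.swap) (simp add: ac_simps)
  also have "\<dots> = (\<Sum>i<k. c i * (e * vec_index (x i) a))"
  proof (intro sum.cong refl)
    fix i assume "i \<in> {..<k}"
    then have xi: "x i \<in> carrier_vec m" "A *\<^sub>v x i = e \<cdot>\<^sub>v x i" using x by auto
    have "(\<Sum>j<m. A $$ (a, j) * vec_index (x i) j) = vec_index (A *\<^sub>v x i) a"
      using mult_mat_vec_sum[OF A xi(1) a] by simp
    then show "c i * (\<Sum>j<m. A $$ (a, j) * vec_index (x i) j) = c i * (e * vec_index (x i) a)"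
      using xi a by simp
  qed
  also have "\<dots> = vec_index (e \<cdot>\<^sub>v lin_comb m k c x) a"
    using a by (simp add: lin_comb_def sum_distrib_left ac_simps)
  finally show "vec_index (A *\<^sub>v lin_comb m k c x) a = vec_index (e \<cdot>\<^sub>v lin_comb m k c x) a" .
qed (use A in \<open>auto simp: lin_comb_def\<close>)

text \<open>The cross product of the coefficient vectors is a witness unless they are parallel; then a vector orthogonal to a
  nonzero one of them is, and if both vanish any vector will do.\<close>

lemma two_functionals_common_zero:
  fixes f g :: "nat \<Rightarrow> real"
  shows "\<exists>c. (\<exists>i<3. c i \<noteq> 0) \<and> (\<Sum>i<3. c i * f i) = 0 \<and> (\<Sum>i<3. c i * g i) = (0::real)"
proof -
  have sum3: "(\<Sum>i<3. h i) = h 0 + h 1 + h 2" for h :: "nat \<Rightarrow> real"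
    by (simp add: numeral_3_eq_3 numeral_2_eq_2)
  have ex: ?thesis if "c 0 \<noteq> 0 \<or> c 1 \<noteq> 0 \<or> c 2 \<noteq> 0"
    "c 0 * f 0 + c 1 * f 1 + c 2 * f 2 = 0" "c 0 * g 0 + c 1 * g 1 + c 2 * g 2 = 0" for c :: "nat \<Rightarrow> real"
  proof -
    have "(0::nat) < 3" "(1::nat) < 3" "(2::nat) < 3" by simp_all
    with that(1) have "\<exists>i<3. c i \<noteq> 0" by blast
    then show ?thesis using that(2,3) unfolding sum3 by blast
  qed
  define v where "v a b d = (\<lambda>i::nat. if i = 0 then a else if i = 1 then b else (d::real))" for a b d
  have v: "v a b d 0 = a" "v a b d (Suc 0) = b" "v a b d 2 = d" for a b d by (simp_all add: v_def)
  let ?x = "f 1 * g 2 - f 2 * g 1" and ?y = "f 2 * g 0 - f 0 * g 2" and ?z = "f 0 * g 1 - f 1 * g 0"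
  show ?thesis
  proof (cases "?x = 0 \<and> ?y = 0 \<and> ?z = 0")
    case False
    then show ?thesis by (intro ex[of "v ?x ?y ?z"]) (auto simp: v algebra_simps)
  next
    case True
    show ?thesis
    proof (cases "f 0 = 0 \<and> f 1 = 0")
      case f01: True
      show ?thesis
      proof (cases "f 2 = 0")
        case f2: True
        show ?thesis
        proof (cases "g 0 = 0 \<and> g 1 = 0")
          case True
          then show ?thesis using f01 f2 by (intro ex[of "v 1 0 0"]) (auto simp: v)
        next
          case False
          then show ?thesis using f01 f2 by (intro ex[of "v (g 1) (- g 0) 0"]) (auto simp: v)
        qed
      next
        case False
        then have "g 0 = 0" using f01 True by simp
        then show ?thesis using f01 by (intro ex[of "v 1 0 0"]) (auto simp: v)
      qed
    next
      case False
      then show ?thesis using True by (intro ex[of "v (f 1) (- f 0) 0"]) (auto simp: v algebra_simps)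
    qed
  qed
qed

lemma component_halves_lin_comb:
  assumes n: "n > 0" and i: "i \<in> UNIV \<times> {..<n}"
  shows "component (p_half (vec_index (lin_comb (4 * n) k c x))) (p_half (\<lambda>j. vec_index (lin_comb (4 * n) k c x) (2 * n + j))) i
     = (\<Sum>l<k. c l * component (p_half (vec_index (x l))) (p_half (\<lambda>j. vec_index (x l) (2 * n + j))) i)"
   "component (q_half (vec_index (lin_comb (4 * n) k c x))) (q_half (\<lambda>j. vec_index (lin_comb (4 * n) k c x) (2 * n + j))) i
     = (\<Sum>l<k. c l * component (q_half (vec_index (x l))) (q_half (\<lambda>j. vec_index (x l) (2 * n + j))) i)"
proof -
  obtain h m where hm: "i = (h, m)" by (cases i)
  have m: "m < n" using i hm by simp
  then have b: "2 * m + 1 < 4 * n" "2 * n + (2 * m + 1) < 4 * n" "2 * m < 4 * n" "2 * n + 2 * m < 4 * n" by linarith+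
  have idx: "vec_index (lin_comb (4 * n) k c x) a = (\<Sum>l<k. c l * vec_index (x l) a)" if "a < 4 * n" for a
    using that by (simp add: lin_comb_def)
  have z: "0 < 4 * n" "2 * n < 4 * n" "1 < 4 * n" "2 * n + 1 < 4 * n" using n by linarith+
  show "component (p_half (vec_index (lin_comb (4 * n) k c x))) (p_half (\<lambda>j. vec_index (lin_comb (4 * n) k c x) (2 * n + j))) i
     = (\<Sum>l<k. c l * component (p_half (vec_index (x l))) (p_half (\<lambda>j. vec_index (x l) (2 * n + j))) i)"
    unfolding hm component_def p_half_def prod.case
    by (cases h; cases "m = 0") (simp_all only: HOL.simp_thms if_True if_False add_0_right idx[OF b(1)] idx[OF b(2)] idx[OF z(1)] idx[OF z(2)])
  show "component (q_half (vec_index (lin_comb (4 * n) k c x))) (q_half (\<lambda>j. vec_index (lin_comb (4 * n) k c x) (2 * n + j))) i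
     = (\<Sum>l<k. c l * component (q_half (vec_index (x l))) (q_half (\<lambda>j. vec_index (x l) (2 * n + j))) i)"
    unfolding hm component_def q_half_def prod.case
    by (cases h; cases "m = 0") (simp_all only: HOL.simp_thms if_True if_False idx[OF b(3)] idx[OF b(4)] idx[OF z(3)] idx[OF z(4)]
        mult_minus_right sum_negf)
qed

text \<open>On the eigenspace of \<open>e\<close>, let \<open>f\<close> and \<open>g\<close> be the pivot entries of the two halves; together they are injective.
  Thus there are at most two independent eigenvectors. If there are two, some nonzero combination
  is annihilated by \<open>f\<close>, so that its first half vanishes and its second half does not, and likewise with
  \<open>g\<close>: then \<open>e\<close> is an eigenvalue of both halves.\<close>

lemma pencil_eigenvalue_orders:
  assumes n: "n \<ge> 4"
  shows "Polynomial.order e (char_poly (pencil_mat n 0)) \<le> 2"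
    and "Polynomial.order e (char_poly (pencil_mat n 0)) = 2 \<Longrightarrow>
      (\<exists>u v k. half_eigenvector n 1 e u v \<and> k < n \<and> (u k \<noteq> 0 \<or> v k \<noteq> 0)) \<and>
      (\<exists>u v k. half_eigenvector n (-1) e u v \<and> k < n \<and> (u k \<noteq> 0 \<or> v k \<noteq> 0))"
proof -
  let ?M = "pencil_mat n 0" and ?m = "4 * n"
  let ?P = "\<lambda>z. p_half (vec_index z)" and ?P' = "\<lambda>z. p_half (\<lambda>j. vec_index z (2 * n + j))"
  let ?Q = "\<lambda>z. q_half (vec_index z)" and ?Q' = "\<lambda>z. q_half (\<lambda>j. vec_index z (2 * n + j))"
  have n0: "n > 0" using n by simp
  note M = pencil_mat_carrier[of n 0] and sym = pencil_mat_symmetric[OF n0, of 0]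
  from pivot_component[OF n, of e] obtain i where i: "i \<in> UNIV \<times> {..<n}" and
    pivot': "\<forall>s u v k. (s = 1 \<or> s = -1) \<longrightarrow> half_eigenvector n s e u v \<longrightarrow>
      component u v i = 0 \<longrightarrow> k < n \<longrightarrow> u k = 0 \<and> v k = 0" by blast
  have pivot: "u k = 0 \<and> v k = 0"
    if "s = 1 \<or> s = -1" "half_eigenvector n s e u v" "component u v i = 0" "k < n" for s u v k
    using pivot' that by blast
  define f where "f z = component (?P z) (?P' z) i" for z
  define g where "g z = component (?Q z) (?Q' z) i" for z
  have Pzero: "?P z k = 0 \<and> ?P' z k = 0"
    if "z \<in> carrier_vec ?m" "?M *\<^sub>v z = e \<cdot>\<^sub>v z" "f z = 0" "k < n" for z k
    by (rule pivot[OF _ eigenvector_halves(1)[OF n that(1,2)] that(3)[unfolded f_def] that(4)]) simp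
  have Qzero: "?Q z k = 0 \<and> ?Q' z k = 0"
    if "z \<in> carrier_vec ?m" "?M *\<^sub>v z = e \<cdot>\<^sub>v z" "g z = 0" "k < n" for z k
    by (rule pivot[OF _ eigenvector_halves(2)[OF n that(1,2)] that(3)[unfolded g_def] that(4)]) simp
  have comb: "lin_comb ?m k c x \<in> carrier_vec ?m" for k c x by (simp add: lin_comb_def)
  have combf: "f (lin_comb ?m k c x) = (\<Sum>l<k. c l * f (x l))"
    and combg: "g (lin_comb ?m k c x) = (\<Sum>l<k. c l * g (x l))" for k c x
    unfolding f_def g_def by (rule component_halves_lin_comb[OF n0 i])+
  have independent_eigenvectors: "\<exists>x. (\<forall>i<k. x i \<in> carrier_vec ?m \<and> ?M *\<^sub>v x i = e \<cdot>\<^sub>v x i) \<and>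
      (\<forall>c. lin_comb ?m k c x = 0\<^sub>v ?m \<longrightarrow> (\<forall>l<k. c l = 0))"
    if k: "k \<le> Polynomial.order e (char_poly ?M)" for k
  proof (rule symmetric_eigenvectors[OF M sym k])
    fix x assume x: "\<And>i. i < k \<Longrightarrow> x i \<in> carrier_vec ?m \<and> ?M *\<^sub>v x i = e \<cdot>\<^sub>v x i"
      and ind: "\<And>c. (\<And>a. a < ?m \<Longrightarrow> (\<Sum>i<k. c i * vec_index (x i) a) = 0) \<Longrightarrow> \<forall>i<k. c i = (0::real)"
    have "\<forall>l<k. c l = 0" if z: "lin_comb ?m k c x = 0\<^sub>v ?m" for c
    proof (rule ind)
      fix a assume a: "a < ?m"
      have "vec_index (lin_comb ?m k c x) a = 0" unfolding z using a by simp
      then show "(\<Sum>i<k. c i * vec_index (x i) a) = 0" using a by (simp add: lin_comb_def)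
    qed
    with x show ?thesis by (intro exI[of _ x]) simp
  qed
  show "Polynomial.order e (char_poly ?M) \<le> 2"
  proof (rule ccontr)
    assume "\<not> ?thesis"
    then have "3 \<le> Polynomial.order e (char_poly ?M)" by simp
    from independent_eigenvectors[OF this] obtain x where
      x: "\<And>i. i < 3 \<Longrightarrow> x i \<in> carrier_vec ?m \<and> ?M *\<^sub>v x i = e \<cdot>\<^sub>v x i"
      and ind: "\<And>c. lin_comb ?m 3 c x = 0\<^sub>v ?m \<Longrightarrow> \<forall>l<3. c l = 0" by blast
    from two_functionals_common_zero[of "\<lambda>l. f (x l)" "\<lambda>l. g (x l)"] obtain c :: "nat \<Rightarrow> real" where
      c: "\<exists>i<3. c i \<noteq> 0" "(\<Sum>l<3. c l * f (x l)) = 0" "(\<Sum>l<3. c l * g (x l)) = 0" by blast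
    let ?z = "lin_comb ?m 3 c x"
    have ez: "?M *\<^sub>v ?z = e \<cdot>\<^sub>v ?z" by (rule lin_comb_eigenvector[OF M x])
    have "f ?z = 0" "g ?z = 0" unfolding combf combg using c by auto
    note zeros = this
    have "?z = 0\<^sub>v ?m"
      by (rule halves_determine_vector[OF comb]) (erule Pzero[OF comb ez zeros(1)], erule Qzero[OF comb ez zeros(2)])
    from ind[OF this] c(1) show False by blast
  qed
  assume "Polynomial.order e (char_poly ?M) = 2"
  then have "2 \<le> Polynomial.order e (char_poly ?M)" by simp
  from independent_eigenvectors[OF this] obtain x where
    x: "\<And>i. i < 2 \<Longrightarrow> x i \<in> carrier_vec ?m \<and> ?M *\<^sub>v x i = e \<cdot>\<^sub>v x i"
    and ind: "\<And>c. lin_comb ?m 2 c x = 0\<^sub>v ?m \<Longrightarrow> \<forall>l<2. c l = 0" by blast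
  have ex: "\<exists>z. z \<in> carrier_vec ?m \<and> ?M *\<^sub>v z = e \<cdot>\<^sub>v z \<and> z \<noteq> 0\<^sub>v ?m \<and> h z = 0"
    if h: "\<And>c. h (lin_comb ?m 2 c x) = (\<Sum>l<2. c l * h (x l))" for h
  proof -
    define c where "c = (\<lambda>l::nat. if h (x 0) = 0 \<and> h (x 1) = 0 then 1 else if l = 0 then h (x 1) else - h (x 0))"
    have "(\<Sum>l<2. c l * h (x l)) = 0" by (auto simp: c_def numeral_2_eq_2)
    moreover have "\<not> (\<forall>l<2. c l = 0)"
    proof
      assume "\<forall>l<2. c l = 0"
      then have "c 0 = 0" "c 1 = 0" by auto
      then show False by (auto simp: c_def split: if_splits)
    qed
    then have "lin_comb ?m 2 c x \<noteq> 0\<^sub>v ?m" using ind by blast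
    moreover have "?M *\<^sub>v lin_comb ?m 2 c x = e \<cdot>\<^sub>v lin_comb ?m 2 c x" by (rule lin_comb_eigenvector[OF M x])
    ultimately show ?thesis using h comb by (intro exI[of _ "lin_comb ?m 2 c x"]) auto
  qed
  obtain z where z: "z \<in> carrier_vec ?m" "?M *\<^sub>v z = e \<cdot>\<^sub>v z" "z \<noteq> 0\<^sub>v ?m" "f z = 0"
    using ex[of f, OF combf] by blast
  obtain y where y: "y \<in> carrier_vec ?m" "?M *\<^sub>v y = e \<cdot>\<^sub>v y" "y \<noteq> 0\<^sub>v ?m" "g y = 0"
    using ex[of g, OF combg] by blast
  have "\<exists>k<n. ?Q z k \<noteq> 0 \<or> ?Q' z k \<noteq> 0"
  proof (rule ccontr)
    assume "\<not> ?thesis"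
    then have "z = 0\<^sub>v ?m"
      by (intro halves_determine_vector[OF z(1)] Pzero[OF z(1,2,4)]) auto
    with z(3) show False by simp
  qed
  moreover have "\<exists>k<n. ?P y k \<noteq> 0 \<or> ?P' y k \<noteq> 0"
  proof (rule ccontr)
    assume "\<not> ?thesis"
    then have "y = 0\<^sub>v ?m"
      by (intro halves_determine_vector[OF y(1)] Qzero[OF y(1,2,4)]) auto
    with y(3) show False by simp
  qed
  ultimately show "(\<exists>u v k. half_eigenvector n 1 e u v \<and> k < n \<and> (u k \<noteq> 0 \<or> v k \<noteq> 0)) \<and>
      (\<exists>u v k. half_eigenvector n (-1) e u v \<and> k < n \<and> (u k \<noteq> 0 \<or> v k \<noteq> 0))"
    using eigenvector_halves(1)[OF n y(1,2)] eigenvector_halves(2)[OF n z(1,2)] by blast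
qed

lemma symmetric_size_proots:
  fixes A :: "real mat"
  assumes "A \<in> carrier_mat m m" "A\<^sup>T = A"
  shows "size (proots (char_poly A)) = m"
proof -
  obtain es where es: "char_poly A = (\<Prod>e\<leftarrow>es. [:-e, 1:])" "length es = m"
    using symmetric_char_poly_split[OF assms] by blast
  have "size (proots (\<Prod>e\<leftarrow>es. [:-e, 1:])) = length es"
  proof (induction es)
    case (Cons a es)
    have "(\<Prod>e\<leftarrow>es. [:-e, 1:]) \<noteq> (0 :: real poly)" by (auto simp: prod_list_zero_iff)
    then have "proots (\<Prod>e\<leftarrow>a # es. [:-e, 1:]) = proots [:-a, 1:] + proots (\<Prod>e\<leftarrow>es. [:-e, 1:])"
      by (simp only: list.map prod_list.Cons) (rule proots_mult, simp_all)
    also have "proots [:-a, 1:] = {#a#}" using proots_linear_factor[of "-a"] by (simp only: minus_minus)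
    finally show ?case using Cons.IH by simp
  qed simp
  then show ?thesis using es by simp
qed

text \<open>With \<open>s\<close> simple and \<open>t\<close> double eigenvalues, \<open>4 n = s + 2 t\<close> and \<open>t \<le> 2 n - 6\<close>.\<close>

lemma many_simple_roots_at_0:
  assumes n: "n \<ge> 4"
  shows "6 \<le> card {e. Polynomial.order e (char_poly (pencil_mat n 0)) = 1}"
proof -
  let ?p = "char_poly (pencil_mat n 0)" and ?R = "{e. poly (char_poly (pencil_mat n 0)) e = 0}"
  let ?S = "\<lambda>k. {e. Polynomial.order e (char_poly (pencil_mat n 0)) = k}"
  have p0: "?p \<noteq> 0" using degree_monic_char_poly[OF pencil_mat_carrier[of n 0]] n by auto
  have fin: "finite ?R" by (rule poly_roots_finite[OF p0])
  have R: "?R = ?S 1 \<union> ?S 2"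
  proof (rule Set.set_eqI, rule iffI)
    fix e assume "e \<in> ?R"
    then have "Polynomial.order e ?p \<noteq> 0" using p0 by (simp add: order_root)
    moreover have "Polynomial.order e ?p \<le> 2" by (rule pencil_eigenvalue_orders(1)[OF n])
    ultimately show "e \<in> ?S 1 \<union> ?S 2" by auto
  next
    fix e assume "e \<in> ?S 1 \<union> ?S 2"
    then show "e \<in> ?R" by (auto simp: order_root)
  qed
  have "4 * n = size (proots ?p)"
    using symmetric_size_proots[OF pencil_mat_carrier pencil_mat_symmetric] n by simp
  also have "\<dots> = (\<Sum>e\<in>?R. Polynomial.order e ?p)" using p0 by (simp add: size_multiset_overloaded_eq)
  also have "\<dots> = (\<Sum>e\<in>?S 1. Polynomial.order e ?p) + (\<Sum>e\<in>?S 2. Polynomial.order e ?p)"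
    using fin unfolding R by (intro sum.union_disjoint) auto
  also have "\<dots> = card (?S 1) + 2 * card (?S 2)" by simp
  finally have count: "4 * n = card (?S 1) + 2 * card (?S 2)" .
  have "card (?S 2) \<le> 2 * n - 6"
    using pencil_eigenvalue_orders(2)[OF n] by (intro card_common_eigenvalues[OF n]) auto
  with count n show ?thesis by linarith
qed

lemma A_mat_affine:
  assumes "i < 2 * n" "j < 2 * n"
  shows "A_mat n b $$ (i, j) = A_mat n 0 $$ (i, j) + b * (A_mat n 1 $$ (i, j) - A_mat n 0 $$ (i, j))"
proof -
  define k s l t where "k = i div 2" "s = i mod 2" "l = j div 2" "t = j mod 2"
  have i: "i = 2 * k + s" and j: "j = 2 * l + t" and st: "s < 2" "t < 2" and kl: "k < n" "l < n"
    unfolding k_s_l_t_def using assms by auto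
  show ?thesis unfolding i j A_mat_entry[OF kl st] A_entry_eq[OF st] by (auto simp: algebra_simps)
qed

lemma pencil_mat_polynomial:
  obtains M :: "real poly mat" where "M \<in> carrier_mat (4 * n) (4 * n)"
    "\<And>b. map_mat (\<lambda>p. poly p b) M = pencil_mat n b"
proof -
  define A where "A = mat (2 * n) (2 * n) (\<lambda>(i, j). [:A_mat n 0 $$ (i, j), A_mat n 1 $$ (i, j) - A_mat n 0 $$ (i, j):])"
  define M where "M = mat (4 * n) (4 * n) (\<lambda>(i, j).
     [:X_mat $$ (i div (2 * n), j div (2 * n)):] * (A * A) $$ (i mod (2 * n), j mod (2 * n))
     + [:Y_mat n $$ (i div (2 * n), j div (2 * n)) * K_mat n 0 $$ (i mod (2 * n), j mod (2 * n)):])"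
  have cA: "A \<in> carrier_mat (2 * n) (2 * n)" by (simp add: A_def)
  have evA: "map_mat (\<lambda>p. poly p b) A = A_mat n b" for b
    using A_mat_carrier[of n b] A_mat_affine[of _ n _ b] by (intro eq_matI) (auto simp: A_def)
  have evH: "map_mat (\<lambda>p. poly p b) (A * A) = H_mat n b" for b
    unfolding H_mat_def evA[symmetric] by (rule semiring_hom.mat_hom_mult[OF _ cA cA]) unfold_locales
  have "map_mat (\<lambda>p. poly p b) M = pencil_mat n b" for b
  proof (rule eq_matI)
    fix i j assume "i < dim_row (pencil_mat n b)" "j < dim_col (pencil_mat n b)"
    then have ij: "i < 4 * n" "j < 4 * n" using pencil_mat_carrier[of n b] by auto
    then have m: "i mod (2 * n) < 2 * n" "j mod (2 * n) < 2 * n" by auto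
    have "poly ((A * A) $$ (i mod (2 * n), j mod (2 * n))) b = H_mat n b $$ (i mod (2 * n), j mod (2 * n))"
      unfolding evH[symmetric] using m cA by auto
    \<comment> \<open>K is constant, so only A has to be lifted to a matrix of polynomials in b.\<close>
    moreover have "K_mat n b = K_mat n 0" by (simp add: K_mat_eq)
    ultimately show "map_mat (\<lambda>p. poly p b) M $$ (i, j) = pencil_mat n b $$ (i, j)"
      unfolding pencil_mat_entry[OF ij] using ij by (simp add: M_def)
  qed (use pencil_mat_carrier[of n b] in \<open>auto simp: M_def\<close>)
  then show ?thesis using that[of M] by (simp add: M_def)
qed

theorem theorem4:
  fixes n :: nat
  assumes "n \<ge> 4"
  shows "AE b in lebesgue. b \<noteq> 0 \<longrightarrow>
    card {e :: real. simple_eigenvalue (X_mat \<otimes>\<^sub>K H_mat n b + Y_mat n \<otimes>\<^sub>K K_mat n b) e} \<ge> 6"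
proof -
  obtain M :: "real poly mat" where M: "M \<in> carrier_mat (4 * n) (4 * n)"
    and ev: "\<And>b. map_mat (\<lambda>p. poly p b) M = pencil_mat n b"
    using pencil_mat_polynomial by blast
  have spec: "specialize b (char_poly M) = char_poly (pencil_mat n b)" for b
    using poly_hom.char_poly_hom[OF M, of b] unfolding ev by simp
  have cp: "degree (char_poly M) = 4 * n" "lead_coeff (char_poly M) = 1"
    using degree_monic_char_poly[OF M] by auto
  have "finite {b. card {e. Polynomial.order e (specialize b (char_poly M)) = 1} < 6}"
  proof (rule finite_fewer_simple_roots[OF cp(2)])
    show "size (proots (specialize b (char_poly M))) = degree (char_poly M)" for b
      unfolding spec cp(1) using assms by (intro symmetric_size_proots pencil_mat_carrier pencil_mat_symmetric) simp
    show "6 \<le> card {e. Polynomial.order e (specialize 0 (char_poly M)) = 1}"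
      unfolding spec by (rule many_simple_roots_at_0[OF assms])
  qed
  then have fin: "finite {b. card {e. Polynomial.order e (char_poly (pencil_mat n b)) = 1} < 6}"
    unfolding spec .
  have simple: "simple_eigenvalue (pencil_mat n b) e \<longleftrightarrow> Polynomial.order e (char_poly (pencil_mat n b)) = 1" for b e
    unfolding simple_eigenvalue_def eigenvalue_root_char_poly[OF pencil_mat_carrier]
    by (auto simp: order_root)
  have "{b. card {e. Polynomial.order e (char_poly (pencil_mat n b)) = 1} < 6} \<in> null_sets lebesgue"
    using fin by (intro null_sets_completionI finite_imp_null_set_lborel)
  from AE_not_in[OF this] have "AE b in lebesgue. 6 \<le> card {e. simple_eigenvalue (pencil_mat n b) e}"
    unfolding simple by (auto simp: not_less)
  then show ?thesis unfolding pencil_mat_def by (rule AE_mp) (rule AE_I2, simp)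
qed

end
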